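(* Let $(\mathcal{X}, d, T)$ be a topological dynamical system. Then $$\overline{\mathrm{mdim}}_M (\mathcal{X}, d, T)=\limsup_{\epsilon\to 0} \frac{1}{\log \frac{1}{\epsilon}} \sup_{\mu \in \mathcal{E}_T(\mathcal{X})} h_\mu^{BK} (\epsilon),$$ and $$\underline{\mathrm{mdim}}_M (\mathcal{X}, d, T)=\liminf_{\epsilon\to 0} \frac{1}{\log \frac{1}{\epsilon}} \sup_{\mu \in \mathcal{E}_T(\mathcal{X})} h_\mu^{BK} (\epsilon).$$
   Context: A topological dynamical system $(\mathcal{X},d,T)$ consists of a compact metric space $(\mathcal{X},d)$ and a homeomorphism $T:\mathcal{X}\to\mathcal{X}$. $\mathcal{E}_T(\mathcal{X})$ denotes the set of ergodic $T$-invariant Borel probability measures on $\mathcal{X}$. For $n\in\mathbb{N}$ set $d_n(x,y)=\max_{0\le k\le n-1} d(T^k x,T^k y)$ and $B_n(x,\epsilon)=\{y\in\mathcal{X}: d_n(x,y)<\epsilon\}$. For $K\subset\mathcal{X}$ and $\epsilon>0$, a set $E\subset K$ is $(n,\epsilon)$-separated if $d_n(x,y)>\epsilon$ for all distinct $x,y\in E$; $s_n(K,\epsilon)$ is the largest cardinality of an $(n,\epsilon)$-separated subset of $K$, and $S(K,\epsilon)=\limsup_{n\to\infty}\frac1n\log s_n(K,\epsilon)$. The upper and lower metric mean dimensions are $$\overline{\mathrm{mdim}}_M(\mathcal{X},d,T)=\limsup_{\epsilon\to0}\frac{S(\mathcal{X},\epsilon)}{\log\frac1\epsilon},\qquad \underline{\mathrm{mdim}}_M(\mathcal{X},d,T)=\liminf_{\epsilon\to0}\frac{S(\mathcal{X},\epsilon)}{\log\frac1\epsilon}.$$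 For a $T$-invariant Borel probability measure $\mu$, $x\in\mathcal{X}$ and $\epsilon>0$, put $$h_\mu^{BK}(x,\epsilon)=\limsup_{n\to\infty}-\frac1n\log\mu(B_n(x,\epsilon)).$$ If $\mu$ is ergodic, then $h_\mu^{BK}(x,\epsilon)$ takes a constant value for $\mu$-a.e. $x$, and this constant is denoted by $h_\mu^{BK}(\epsilon)$ (Brin-Katok local entropy at scale $\epsilon$). *)

theory Defs
  imports "HOL-Probability.Probability"
begin

text \<open>The phase space is the whole type \<open>'a\<close> with its metric \<open>dist\<close>; all the definitions
  below are meant for a compact \<open>UNIV :: 'a set\<close> and a continuous map \<open>T\<close>.
  Growth rates and dimensions take values in \<^typ>\<open>ereal\<close>.\<close>

text \<open>The Bowen metric is only meaningful for \<open>n \<ge> 1\<close>. All later uses are in a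
  limit superior over \<open>n\<close>, so the value at \<open>n = 0\<close> is irrelevant.\<close>

definition bowen_dist :: "('a::metric_space \<Rightarrow> 'a) \<Rightarrow> nat \<Rightarrow> 'a \<Rightarrow> 'a \<Rightarrow> real" where
  "bowen_dist T n x y = (MAX k\<in>{..<n}. dist ((T ^^ k) x) ((T ^^ k) y))"

definition bowen_ball :: "('a::metric_space \<Rightarrow> 'a) \<Rightarrow> nat \<Rightarrow> 'a \<Rightarrow> real \<Rightarrow> 'a set" where
  "bowen_ball T n x \<epsilon> = {y. bowen_dist T n x y < \<epsilon>}"

definition separated :: "('a::metric_space \<Rightarrow> 'a) \<Rightarrow> nat \<Rightarrow> real \<Rightarrow> 'a set \<Rightarrow> bool" where
  "separated T n \<epsilon> E \<longleftrightarrow> (\<forall>x\<in>E. \<forall>y\<in>E. x \<noteq> y \<longrightarrow> bowen_dist T n x y > \<epsilon>)"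

text \<open>On a compact space with \<open>T\<close> continuous, \<open>n \<ge> 1\<close> and \<open>\<epsilon> > 0\<close>, every separated set is
  finite and the cardinalities are bounded, so the maximum below exists.\<close>

definition sep_number :: "('a::metric_space \<Rightarrow> 'a) \<Rightarrow> nat \<Rightarrow> 'a set \<Rightarrow> real \<Rightarrow> nat" where
  "sep_number T n K \<epsilon> = Max {card E |E. E \<subseteq> K \<and> finite E \<and> separated T n \<epsilon> E}"

definition sep_entropy :: "('a::metric_space \<Rightarrow> 'a) \<Rightarrow> 'a set \<Rightarrow> real \<Rightarrow> ereal" where
  "sep_entropy T K \<epsilon> = limsup (\<lambda>n. ereal (1 / real n * ln (real (sep_number T n K \<epsilon>))))"

definition upper_mdim :: "('a::metric_space \<Rightarrow> 'a) \<Rightarrow> ereal" where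
  "upper_mdim T = Limsup (at_right 0) (\<lambda>\<epsilon>. sep_entropy T UNIV \<epsilon> / ereal (ln (1 / \<epsilon>)))"

definition lower_mdim :: "('a::metric_space \<Rightarrow> 'a) \<Rightarrow> ereal" where
  "lower_mdim T = Liminf (at_right 0) (\<lambda>\<epsilon>. sep_entropy T UNIV \<epsilon> / ereal (ln (1 / \<epsilon>)))"

definition invariant_borel_prob :: "('a::topological_space \<Rightarrow> 'a) \<Rightarrow> 'a measure \<Rightarrow> bool" where
  "invariant_borel_prob T \<mu> \<longleftrightarrow> prob_space \<mu> \<and> sets \<mu> = sets borel \<and>
     (\<forall>A\<in>sets borel. emeasure \<mu> (T -` A) = emeasure \<mu> A)"

definition ergodic_measures :: "('a::topological_space \<Rightarrow> 'a) \<Rightarrow> 'a measure set" where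
  "ergodic_measures T = {\<mu>. invariant_borel_prob T \<mu> \<and>
     (\<forall>A\<in>sets borel. T -` A = A \<longrightarrow> measure \<mu> A = 0 \<or> measure \<mu> A = 1)}"

text \<open>The real logarithm has \<open>ln 0 = 0\<close>, so the convention \<open>- log 0 = \<infinity>\<close> for balls of measure
  zero is imposed explicitly.\<close>

definition bk_local_entropy ::
  "('a::metric_space \<Rightarrow> 'a) \<Rightarrow> 'a measure \<Rightarrow> 'a \<Rightarrow> real \<Rightarrow> ereal" where
  "bk_local_entropy T \<mu> x \<epsilon> = limsup (\<lambda>n.
     if measure \<mu> (bowen_ball T n x \<epsilon>) = 0 then \<infinity>
     else ereal (- (1 / real n) * ln (measure \<mu> (bowen_ball T n x \<epsilon>))))"

text \<open>For an ergodic \<open>\<mu>\<close> and \<open>\<epsilon> > 0\<close> the local entropy at scale \<open>\<epsilon>\<close> is almost everywhere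
  constant; the constant is unique because \<open>\<mu>\<close> is a probability measure.\<close>

definition bk_entropy :: "('a::metric_space \<Rightarrow> 'a) \<Rightarrow> 'a measure \<Rightarrow> real \<Rightarrow> ereal" where
  "bk_entropy T \<mu> \<epsilon> = (THE c. AE x in \<mu>. bk_local_entropy T \<mu> x \<epsilon> = c)"

end

theory Submission
  imports Defs "HOL-Real_Asymp.Real_Asymp"
begin

text \<open>
  Up to a constant factor in the scale, \<open>S(\<epsilon>)\<close> and \<open>H(\<epsilon>) = sup\<^sub>\<mu> h\<^sub>\<mu>(\<epsilon>)\<close> bound each other:
  \<open>S(8\<epsilon>) \<le> H(\<epsilon>) \<le> S(\<epsilon>/3)\<close>; constant factors do not matter after division by \<open>log (1/\<epsilon>)\<close>.

  The upper bound is the Borel-Cantelli lemma applied to the points whose Bowen balls are too small.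

  For the lower bound, suppose that \<open>h\<^sub>\<mu>(\<epsilon>) < h\<close> for every ergodic \<open>\<mu>\<close>. Then every ergodic \<open>\<mu>\<close> gives almost
  full measure to a union of \<open>exp(n h)\<close> Bowen balls of length \<open>n\<close>, and there are countably many such
  unions up to enlarging the radius. If the orbit segments that are not almost completely tiled by
  visits to these unions were abundant, a limit of empirical charges would give an invariant measure,
  and then an extreme one among the maximisers, hence an ergodic one, charging the closed set of
  untiled points, which is absurd. So all long orbit segments are tiled, and counting the tilings
  covers the space by about \<open>exp(n h)\<close> sets that are small in the Bowen metric. No entropy of partitions
  enters. Limits of empirical measures are taken as finitely additive charges on the Borel sets,
  whose regularisation replaces the Riesz representation theorem.
\<close>

section \<open>Measures dominating finitely additive charges\<close>

text \<open>The obstacle is uniformity: the length from which Bowen balls reveal the local entropy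
  depends on the measure and on the point, and no length serves all ergodic measures at once.
  Compactness repairs this only for the mass of closed sets, which a passage to a limit measure
  cannot lose. Hence tiled points form open sets, untiled ones a decreasing sequence of closed sets,
  and every comparison of a charge with a measure is an inequality on closed sets, pointing in the
  useful direction. Extremality is likewise tested only through values on countably many closed
  sets.

  The factor 8: a maximal \<open>2 * e\<close>-separated set has disjoint \<open>e\<close>-balls,
  which bounds its size by their mass, and it spans at distance \<open>2 * e\<close>; moving its
  centres into a countable dense set keeps the radius below \<open>4 * e\<close>, and a ball of that
  radius has diameter at most \<open>8 * e\<close>. The factor 3: two points within
  \<open>e / 3\<close> of a common centre are less than \<open>e\<close> apart.\<close>

definition charge :: "('a::topological_space set \<Rightarrow> real) \<Rightarrow> bool" where
  "charge m \<longleftrightarrow> (\<forall>A. 0 \<le> m A \<and> m A \<le> 1) \<and> m UNIV = 1 \<and>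
     (\<forall>A\<in>sets borel. \<forall>B\<in>sets borel. A \<inter> B = {} \<longrightarrow> m (A \<union> B) = m A + m B)"

lemma charge_bounds: "charge m \<Longrightarrow> 0 \<le> m A" "charge m \<Longrightarrow> m A \<le> 1"
  by (auto simp: charge_def)

lemma charge_UNIV: "charge m \<Longrightarrow> m UNIV = 1"
  by (simp add: charge_def)

lemma charge_Un: "charge m \<Longrightarrow> A \<in> sets borel \<Longrightarrow> B \<in> sets borel \<Longrightarrow> A \<inter> B = {} \<Longrightarrow> m (A \<union> B) = m A + m B"
  by (auto simp: charge_def)

lemma charge_empty: "charge m \<Longrightarrow> m {} = 0"
  using charge_Un[of m "{}" "{}"] by simp

lemma charge_mono:
  assumes "charge m" "A \<in> sets borel" "B \<in> sets borel" "A \<subseteq> B"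
  shows "m A \<le> m B"
proof -
  have "m B = m (A \<union> (B - A))" using assms(4) by (simp add: Un_absorb1)
  also have "\<dots> = m A + m (B - A)" using assms by (intro charge_Un) auto
  finally show ?thesis using charge_bounds(1)[OF assms(1), of "B - A"] by simp
qed

lemma charge_subadditive:
  assumes "charge m" "A \<in> sets borel" "B \<in> sets borel"
  shows "m (A \<union> B) \<le> m A + m B"
proof -
  have "m (A \<union> B) = m (A \<union> (B - A))" by simp
  also have "\<dots> = m A + m (B - A)" using assms by (intro charge_Un) auto
  also have "m (B - A) \<le> m B" using assms by (intro charge_mono) auto
  finally show ?thesis by simp
qed

text \<open>Inner regularisation by closed sets, followed below by outer regularisation by open
  sets, as in the construction of a Radon measure from a content. Values lie in
  \<open>ennreal\<close> because Caratheodory's construction expects them there.\<close>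

definition inner_charge :: "('a::topological_space set \<Rightarrow> real) \<Rightarrow> 'a set \<Rightarrow> ennreal" where
  "inner_charge m U = (SUP K\<in>{K. closed K \<and> K \<subseteq> U}. ennreal (m K))"

definition outer_charge :: "('a::topological_space set \<Rightarrow> real) \<Rightarrow> 'a set \<Rightarrow> ennreal" where
  "outer_charge m A = (INF U\<in>{U. open U \<and> A \<subseteq> U}. inner_charge m U)"

lemma inner_charge_upper: "closed K \<Longrightarrow> K \<subseteq> U \<Longrightarrow> ennreal (m K) \<le> inner_charge m U"
  by (auto simp: inner_charge_def intro!: SUP_upper)

lemma inner_charge_mono: "U \<subseteq> V \<Longrightarrow> inner_charge m U \<le> inner_charge m V"
  unfolding inner_charge_def by (intro SUP_subset_mono) auto

lemma outer_charge_mono: "A \<subseteq> B \<Longrightarrow> outer_charge m A \<le> outer_charge m B"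
  unfolding outer_charge_def by (intro INF_superset_mono) auto

lemma outer_charge_open: "open U \<Longrightarrow> outer_charge m U = inner_charge m U"
  unfolding outer_charge_def
  by (intro antisym INF_greatest INF_lower) (auto intro: inner_charge_mono)

text \<open>Normality separates the disjoint closed sets \<open>K - U\<close> and
  \<open>K - V\<close> by open sets; removing these from \<open>K\<close> leaves the two
  pieces.\<close>

lemma closed_subset_Un_split:
  fixes K U V :: "'a::t4_space set"
  assumes "closed K" "open U" "open V" "K \<subseteq> U \<union> V"
  obtains K1 K2 where "closed K1" "closed K2" "K = K1 \<union> K2" "K1 \<subseteq> U" "K2 \<subseteq> V"
proof -
  obtain A B where AB: "open A" "open B" "K - U \<subseteq> A" "K - V \<subseteq> B" "A \<inter> B = {}"
    using t4_space[of "K - U" "K - V"] assms by (metis Diff_disjoint Diff_eq_empty_iff Diff_Int2 Diff_Int closed_Diff inf_commute Diff_Un)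
  show ?thesis
    by (rule that[of "K - A" "K - B"]) (use AB assms in auto)
qed

lemma inner_charge_subadditive:
  fixes m :: "'a::t4_space set \<Rightarrow> real"
  assumes m: "charge m" and "open U" "open V"
  shows "inner_charge m (U \<union> V) \<le> inner_charge m U + inner_charge m V"
proof -
  have "ennreal (m K) \<le> inner_charge m U + inner_charge m V" if "closed K" "K \<subseteq> U \<union> V" for K
  proof -
    obtain K1 K2 where K: "closed K1" "closed K2" "K = K1 \<union> K2" "K1 \<subseteq> U" "K2 \<subseteq> V"
      using closed_subset_Un_split \<open>closed K\<close> \<open>open U\<close> \<open>open V\<close> \<open>K \<subseteq> U \<union> V\<close> by metis
    have "ennreal (m K) \<le> ennreal (m K1 + m K2)"
      using charge_subadditive[OF m, of K1 K2] K by (intro ennreal_leI) auto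
    also have "\<dots> = ennreal (m K1) + ennreal (m K2)"
      using charge_bounds[OF m] by (intro ennreal_plus) auto
    also have "\<dots> \<le> inner_charge m U + inner_charge m V"
      using K by (intro add_mono inner_charge_upper) auto
    finally show ?thesis .
  qed
  then show ?thesis unfolding inner_charge_def[of m "U \<union> V"] by (intro SUP_least) auto
qed

text \<open>This is where compactness creates countable additivity out of finite additivity: a
  closed subset of the union already lies in finitely many \<open>U i\<close>.\<close>

lemma inner_charge_countably_subadditive:
  fixes m :: "'a::t4_space set \<Rightarrow> real" and U :: "nat \<Rightarrow> 'a set"
  assumes "compact (UNIV :: 'a set)" and m: "charge m" and U: "\<And>i. open (U i)"
  shows "inner_charge m (\<Union>i. U i) \<le> (\<Sum>i. inner_charge m (U i))"
proof -
  have fin: "inner_charge m (\<Union>i<n. U i) \<le> (\<Sum>i<n. inner_charge m (U i))" for n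
  proof (induction n)
    case 0
    show ?case using charge_empty[OF m] by (simp add: inner_charge_def)
  next
    case (Suc n)
    have "inner_charge m (\<Union>i<Suc n. U i) \<le> inner_charge m (\<Union>i<n. U i) + inner_charge m (U n)"
      using inner_charge_subadditive[OF m, of "\<Union>i<n. U i" "U n"] U by (auto simp: lessThan_Suc Un_commute)
    with Suc show ?case by (auto intro: order_trans add_right_mono)
  qed
  have "ennreal (m K) \<le> (\<Sum>i. inner_charge m (U i))" if K: "closed K" "K \<subseteq> (\<Union>i. U i)" for K
  proof -
    have "compact K" using compact_Int_closed[OF assms(1) K(1)] by simp
    then obtain D where D: "D \<subseteq> (UNIV :: nat set)" "finite D" "K \<subseteq> (\<Union>i\<in>D. U i)"
      using K U by (metis compactE_image)
    obtain n where "D \<subseteq> {..<n}" using D(2) finite_nat_iff_bounded by auto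
    then have "K \<subseteq> (\<Union>i<n. U i)" using D by blast
    then have "ennreal (m K) \<le> (\<Sum>i<n. inner_charge m (U i))"
      using inner_charge_upper[OF K(1)] fin order_trans by blast
    also have "\<dots> \<le> (\<Sum>i. inner_charge m (U i))" by (intro sum_le_suminf) auto
    finally show ?thesis .
  qed
  then show ?thesis unfolding inner_charge_def[of m "\<Union>i. U i"] by (intro SUP_least) auto
qed

lemma outer_measure_space_outer_charge:
  fixes m :: "'a::t4_space set \<Rightarrow> real"
  assumes cpt: "compact (UNIV :: 'a set)" and m: "charge m"
  shows "outer_measure_space (Pow UNIV) (outer_charge m)"
  unfolding outer_measure_space_def
proof (intro conjI)
  show "positive (Pow UNIV) (outer_charge m)"
    using charge_empty[OF m] by (simp add: positive_def outer_charge_open inner_charge_def)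
  show "increasing (Pow UNIV) (outer_charge m)"
    by (auto simp: increasing_def intro: outer_charge_mono)
  show "countably_subadditive (Pow UNIV) (outer_charge m)"
    unfolding countably_subadditive_def
  proof (intro allI impI)
    fix A :: "nat \<Rightarrow> 'a set"
    show "outer_charge m (\<Union>i. A i) \<le> (\<Sum>n. outer_charge m (A n))"
    proof (rule ennreal_le_epsilon)
      fix e :: real assume fin: "(\<Sum>n. outer_charge m (A n)) < top" and "0 < e"
      have "\<exists>U. open U \<and> A n \<subseteq> U \<and> inner_charge m U \<le> outer_charge m (A n) + e * (1/2)^Suc n" for n
      proof -
        have "outer_charge m (A n) \<le> (\<Sum>n. outer_charge m (A n))"
          using sum_le_suminf[of "\<lambda>n. outer_charge m (A n)" "{n}"] by auto
        then have "outer_charge m (A n) < top" using fin by simp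
        \<comment> \<open>Strictness needs the finiteness just obtained: in \<open>ennreal\<close>
          adding to \<open>top\<close> changes nothing.\<close>
        then have "outer_charge m (A n) < outer_charge m (A n) + e * (1/2)^Suc n"
          using \<open>0 < e\<close> by (cases "outer_charge m (A n)") (auto simp: ennreal_plus[symmetric] ennreal_less_iff simp del: ennreal_plus)
        then show ?thesis
          unfolding outer_charge_def[of m "A n"] INF_less_iff by (auto intro: less_imp_le)
      qed
      then obtain U where U: "\<And>n. open (U n)" "\<And>n. A n \<subseteq> U n"
          "\<And>n. inner_charge m (U n) \<le> outer_charge m (A n) + e * (1/2)^Suc n"
        by metis
      have "outer_charge m (\<Union>i. A i) \<le> outer_charge m (\<Union>i. U i)"
        using U by (intro outer_charge_mono) blast
      also have "\<dots> = inner_charge m (\<Union>i. U i)" using U by (intro outer_charge_open) auto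
      also have "\<dots> \<le> (\<Sum>n. inner_charge m (U n))"
        by (rule inner_charge_countably_subadditive[OF cpt m U(1)])
      also have "\<dots> \<le> (\<Sum>n. outer_charge m (A n) + e * (1/2)^Suc n)"
        using U by (intro suminf_le) auto
      also have "\<dots> = (\<Sum>n. outer_charge m (A n)) + (\<Sum>n. ennreal (e * (1/2)^Suc n))"
        by (intro suminf_add[symmetric]) auto
      also have "(\<Sum>n. ennreal (e * (1/2)^Suc n)) = ennreal e"
        using \<open>0 < e\<close> sums_mult[OF power_half_series, of e] by (intro suminf_ennreal_eq) auto
      finally show "outer_charge m (\<Union>i. A i) \<le> (\<Sum>n. outer_charge m (A n)) + e" .
    qed
  qed
qed

text \<open>For an open test set \<open>V\<close>, exhaust \<open>U \<inter> V\<close> by closed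
  sets \<open>K\<close>. Then \<open>V - U\<close> lies in the open set \<open>V - K\<close>, whose
  closed subsets \<open>L\<close> are disjoint from \<open>K\<close>, so the charges of
  \<open>K\<close> and \<open>L\<close> add up inside \<open>V\<close>. Arbitrary test sets follow
  by taking open supersets.\<close>

lemma open_mem_lambda_system:
  fixes m :: "'a::t4_space set \<Rightarrow> real"
  assumes cpt: "compact (UNIV :: 'a set)" and m: "charge m" and U: "open U"
  shows "U \<in> lambda_system UNIV (Pow UNIV) (outer_charge m)"
proof -
  interpret algebra UNIV "Pow (UNIV :: 'a set)" by (rule algebra_Pow)
  have oms: "outer_measure_space (Pow UNIV) (outer_charge m)"
    by (rule outer_measure_space_outer_charge[OF cpt m])
  have le: "outer_charge m A \<le> outer_charge m (U \<inter> A) + outer_charge m (A - U)" for A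
  proof -
    have "subadditive (Pow UNIV) (outer_charge m)"
      using oms by (intro countably_subadditive_subadditive) (auto simp: outer_measure_space_def simp del: Pow_UNIV)
    from this[unfolded subadditive_def, rule_format, of "U \<inter> A" "A - U"]
    have "outer_charge m ((U \<inter> A) \<union> (A - U)) \<le> outer_charge m (U \<inter> A) + outer_charge m (A - U)"
      by blast
    moreover have "(U \<inter> A) \<union> (A - U) = A" by auto
    ultimately show ?thesis by simp
  qed
  have ge_open: "outer_charge m (U \<inter> V) + outer_charge m (V - U) \<le> inner_charge m V" if V: "open V" for V
  proof -
    have 1: "ennreal (m K) + outer_charge m (V - U) \<le> inner_charge m V" if K: "closed K" "K \<subseteq> U \<inter> V" for K
    proof -
      have "outer_charge m (V - U) \<le> inner_charge m (V - K)"
        using K V unfolding outer_charge_def by (intro INF_lower) auto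
      moreover have "ennreal (m K) + inner_charge m (V - K) \<le> inner_charge m V"
      proof -
        have "ennreal (m K) + ennreal (m L) \<le> inner_charge m V" if L: "closed L" "L \<subseteq> V - K" for L
        proof -
          have "ennreal (m K) + ennreal (m L) = ennreal (m K + m L)"
            using charge_bounds[OF m] by (intro ennreal_plus[symmetric]) auto
          also have "m K + m L = m (K \<union> L)"
            using K L by (intro charge_Un[OF m, symmetric]) auto
          also have "ennreal (m (K \<union> L)) \<le> inner_charge m V"
            using K L by (intro inner_charge_upper) auto
          finally show ?thesis .
        qed
        then show ?thesis
          unfolding inner_charge_def[of m "V - K"]
          by (subst ennreal_SUP_add_right) (auto intro!: SUP_least)
      qed
      ultimately show ?thesis by (meson add_left_mono order_trans)
    qed
    have eq: "outer_charge m (U \<inter> V) = inner_charge m (U \<inter> V)"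
      using U V by (intro outer_charge_open) auto
    show ?thesis
      unfolding eq inner_charge_def[of m "U \<inter> V"]
      by (subst ennreal_SUP_add_left[symmetric]) (auto intro!: SUP_least 1)
  qed
  have "outer_charge m (U \<inter> A) + outer_charge m (A - U) \<le> outer_charge m A" for A
    unfolding outer_charge_def[of m A]
  proof (rule INF_greatest)
    fix V assume "V \<in> {V. open V \<and> A \<subseteq> V}"
    then have "outer_charge m (U \<inter> A) + outer_charge m (A - U) \<le> outer_charge m (U \<inter> V) + outer_charge m (V - U)"
      by (intro add_mono outer_charge_mono) auto
    also have "\<dots> \<le> inner_charge m V" using ge_open \<open>V \<in> _\<close> by auto
    finally show "outer_charge m (U \<inter> A) + outer_charge m (A - U) \<le> inner_charge m V" .
  qed
  then have "outer_charge m (U \<inter> A) + outer_charge m ((UNIV - U) \<inter> A) = outer_charge m A" for A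
    using le[of A] by (simp add: antisym Diff_eq Int_commute)
  then show ?thesis unfolding lambda_system_def by simp
qed

text \<open>Regularisation moves mass only towards closed sets: every open superset of a closed
  \<open>K\<close> has inner charge at least \<open>m K\<close>. The total mass stays 1 because
  \<open>UNIV\<close> is itself closed.\<close>

theorem charge_dominated_by_measure:
  fixes m :: "'a::t4_space set \<Rightarrow> real"
  assumes cpt: "compact (UNIV :: 'a set)" and m: "charge m"
  obtains \<mu> where "prob_space \<mu>" "sets \<mu> = sets borel"
    "\<And>A. A \<in> sets borel \<Longrightarrow> emeasure \<mu> A = outer_charge m A"
    "\<And>K. closed K \<Longrightarrow> m K \<le> measure \<mu> K"
proof -
  interpret sigma_algebra UNIV "Pow (UNIV :: 'a set)" by (rule sigma_algebra_Pow)
  let ?L = "lambda_system UNIV (Pow UNIV) (outer_charge m)"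
  have L: "measure_space UNIV ?L (outer_charge m)"
    by (rule caratheodory_lemma[OF outer_measure_space_outer_charge[OF cpt m]])
  then interpret L: sigma_algebra UNIV ?L by (simp add: measure_space_def)
  have "sets (borel :: 'a measure) \<subseteq> ?L"
    unfolding sets_borel by (intro L.sigma_sets_subset subsetI open_mem_lambda_system[OF cpt m]) simp
  then have ms: "measure_space UNIV (sets borel) (outer_charge m)"
    using measure_down[OF L] sets.sigma_algebra_axioms[of borel] by auto
  define \<mu> :: "'a measure" where "\<mu> = measure_of UNIV (sets borel) (outer_charge m)"
  have sets: "sets \<mu> = sets borel"
    unfolding \<mu>_def using sets.sigma_sets_eq[of borel] by (simp add: sets_measure_of_conv)
  have em: "emeasure \<mu> A = outer_charge m A" if "A \<in> sets borel" for A
  proof -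
    have "measure_space (space borel) (sets borel) (outer_charge m)" using ms by simp
    then show ?thesis unfolding \<mu>_def
      using emeasure_measure_of_sigma[of UNIV "sets borel" "outer_charge m" A] that
      by (auto simp: measure_space_def)
  qed
  have "emeasure \<mu> UNIV = 1"
  proof -
    have "inner_charge m UNIV = 1"
    proof (rule antisym)
      show "inner_charge m UNIV \<le> 1"
        unfolding inner_charge_def using charge_bounds[OF m] by (auto intro!: SUP_least)
      show "1 \<le> inner_charge m UNIV"
        using inner_charge_upper[of UNIV UNIV m] charge_UNIV[OF m] by simp
    qed
    then show ?thesis by (simp add: em outer_charge_open)
  qed
  then have prob: "prob_space \<mu>"
    using sets_eq_imp_space_eq[OF sets] by (intro prob_spaceI) simp
  then interpret \<mu>: prob_space \<mu> .
  have "m K \<le> measure \<mu> K" if "closed K" for K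
  proof -
    have "ennreal (m K) \<le> emeasure \<mu> K"
      using that by (subst em) (auto simp: outer_charge_def intro!: INF_greatest inner_charge_upper)
    then show ?thesis
      by (simp add: \<mu>.emeasure_eq_measure)
  qed
  then show ?thesis by (intro that[OF prob sets em])
qed

section \<open>Invariant charges\<close>

lemma INT_decseq_nonempty:
  fixes F :: "nat \<Rightarrow> 'b::topological_space set"
  assumes "compact S" "\<And>n. closed (F n)" "\<And>n. F n \<subseteq> S" "\<And>n. F n \<noteq> {}" "decseq F"
  shows "(\<Inter>n. F n) \<noteq> {}"
proof -
  have "S \<inter> (\<Inter>n\<in>UNIV. F n) \<noteq> {}"
  proof (rule compact_imp_fip_image[OF assms(1,2)])
    fix I :: "nat set" assume "finite I"
    then obtain N where "I \<subseteq> {..N}" using finite_nat_iff_bounded_le by auto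
    then have "F N \<subseteq> (\<Inter>i\<in>I. F i)" using \<open>decseq F\<close> by (auto simp: decseq_def)
    then show "S \<inter> (\<Inter>i\<in>I. F i) \<noteq> {}" using assms(3,4)[of N] by blast
  qed
  then show ?thesis by auto
qed

lemma closed_Collect_imp_const:
  "closed {x. Q x} \<Longrightarrow> closed {x. P \<longrightarrow> Q x}"
  by (cases P) auto

lemma closed_charges: "closed {m :: 'a::topological_space set \<Rightarrow> real. charge m}"
  unfolding charge_def Ball_def
  by (intro closed_Collect_conj closed_Collect_all closed_Collect_imp_const closed_Collect_le closed_Collect_eq
      continuous_intros continuous_on_product_coordinates)

text \<open>Tychonoff's theorem. \<open>charge\<close> bounds \<open>m\<close> on all sets, Borel or
  not, so charges lie in a cube; each defining condition involves finitely many coordinates and is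
  therefore closed.\<close>

lemma compact_charges: "compact {m :: 'a::topological_space set \<Rightarrow> real. charge m}"
proof -
  have "compactin (product_topology (\<lambda>_::'a set. euclideanreal) UNIV) (PiE UNIV (\<lambda>_. {0..1}))"
    by (simp add: compactin_PiE)
  then have box: "compact (PiE UNIV (\<lambda>_. {0..1}) :: ('a set \<Rightarrow> real) set)"
    by (simp add: euclidean_product_topology)
  moreover have "{m :: 'a set \<Rightarrow> real. charge m} \<subseteq> PiE UNIV (\<lambda>_. {0..1})"
    by (auto simp: charge_def)
  ultimately show ?thesis
    using compact_Int_closed[OF box closed_charges] by (metis inf.absorb2)
qed

definition invariant_charges :: "('a::topological_space \<Rightarrow> 'a) \<Rightarrow> ('a set \<Rightarrow> real) set" where
  "invariant_charges T = {m. charge m \<and> (\<forall>A\<in>sets borel. m (T -` A) = m A)}"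

lemma compact_invariant_charges: "compact (invariant_charges T)"
proof -
  have "closed {m :: 'a set \<Rightarrow> real. \<forall>A\<in>sets borel. m (T -` A) = m A}" 
    unfolding Ball_def
    by (intro closed_Collect_all closed_Collect_imp_const closed_Collect_eq continuous_on_product_coordinates)
  from compact_Int_closed[OF compact_charges this] show ?thesis
    by (simp add: invariant_charges_def Collect_conj_eq)
qed

lemma vimage_borel: "continuous_on UNIV T \<Longrightarrow> A \<in> sets borel \<Longrightarrow> T -` A \<in> sets borel"
  using measurable_sets[OF borel_measurable_continuous_onI, of T A] by simp

lemma measure_in_invariant_charges:
  assumes "invariant_borel_prob T \<mu>"
  shows "measure \<mu> \<in> invariant_charges T"
proof -
  interpret prob_space \<mu> using assms by (simp add: invariant_borel_prob_def)
  have [simp]: "sets \<mu> = sets borel" using assms by (simp add: invariant_borel_prob_def)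
  have sp: "space \<mu> = UNIV" using sets_eq_imp_space_eq[OF \<open>sets \<mu> = sets borel\<close>] by simp
  show ?thesis
    unfolding invariant_charges_def charge_def mem_Collect_eq
  proof (intro conjI ballI allI impI)
    show "prob UNIV = 1" using prob_space sp by simp
    show "prob (A \<union> B) = prob A + prob B" if "A \<in> sets borel" "B \<in> sets borel" "A \<inter> B = {}" for A B
      using that by (intro finite_measure_Union) auto
    show "prob (T -` A) = prob A" if "A \<in> sets borel" for A
      using assms that by (simp add: invariant_borel_prob_def measure_def)
  qed simp_all
qed

text \<open>The regularised measure must be shown invariant anew. A closed \<open>K\<close> inside
  the preimage of \<open>U\<close> has a compact image in \<open>U\<close>, and \<open>K\<close>
  lies in the preimage of that image; this gives one inequality for the measure. Applied to
  complements it gives the other, since the total mass is finite.\<close>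

lemma invariant_charge_dominated:
  fixes T :: "'a::t4_space \<Rightarrow> 'a"
  assumes cpt: "compact (UNIV :: 'a set)" and T: "continuous_on UNIV T" and m: "m \<in> invariant_charges T"
  obtains \<mu> where "invariant_borel_prob T \<mu>" "\<And>K. closed K \<Longrightarrow> m K \<le> measure \<mu> K"
proof -
  have ch: "charge m" and inv: "\<And>A. A \<in> sets borel \<Longrightarrow> m (T -` A) = m A"
    using m by (auto simp: invariant_charges_def)
  obtain \<mu> where \<mu>: "prob_space \<mu>" "sets \<mu> = sets borel"
      "\<And>A. A \<in> sets borel \<Longrightarrow> emeasure \<mu> A = outer_charge m A"
      "\<And>K. closed K \<Longrightarrow> m K \<le> measure \<mu> K"
    by (rule charge_dominated_by_measure[OF cpt ch]) (rule that; blast)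
  interpret prob_space \<mu> by fact
  have sp: "space \<mu> = UNIV" using sets_eq_imp_space_eq[OF \<mu>(2)] by simp
  have inner: "inner_charge m (T -` U) \<le> inner_charge m U" for U
    unfolding inner_charge_def[of m "T -` U"]
  proof (rule SUP_least)
    fix K assume K: "K \<in> {K. closed K \<and> K \<subseteq> T -` U}"
    then have "compact K" using compact_Int_closed[OF cpt, of K] by simp
    then have cl: "closed (T ` K)"
      using compact_continuous_image continuous_on_subset[OF T] compact_imp_closed by blast
    have "m K \<le> m (T -` (T ` K))"
      using K cl vimage_borel[OF T, of "T ` K"] by (intro charge_mono[OF ch]) auto
    also have "\<dots> = m (T ` K)" using cl by (intro inv) auto
    finally have "ennreal (m K) \<le> ennreal (m (T ` K))" by (rule ennreal_leI)
    also have "\<dots> \<le> inner_charge m U" using cl K by (intro inner_charge_upper) auto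
    finally show "ennreal (m K) \<le> inner_charge m U" .
  qed
  have "outer_charge m (T -` A) \<le> outer_charge m A" for A
    unfolding outer_charge_def[of m A]
  proof (rule INF_greatest)
    fix U assume U: "U \<in> {U. open U \<and> A \<subseteq> U}"
    then have "open (T -` U)" using T open_vimage by blast
    then have "outer_charge m (T -` A) \<le> inner_charge m (T -` U)"
      using U unfolding outer_charge_def by (intro INF_lower) auto
    also have "\<dots> \<le> inner_charge m U" by (rule inner)
    finally show "outer_charge m (T -` A) \<le> inner_charge m U" .
  qed
  then have le: "prob (T -` A) \<le> prob A" if "A \<in> sets borel" for A
    using that vimage_borel[OF T that] by (metis \<mu>(3) emeasure_eq_measure ennreal_le_iff measure_nonneg)
  have "prob (T -` A) = prob A" if A: "A \<in> sets borel" for A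
  proof (rule antisym)
    have "prob (T -` (UNIV - A)) = 1 - prob (T -` A)" "prob (UNIV - A) = 1 - prob A"
      using prob_compl[of "T -` A"] prob_compl[of A] A vimage_borel[OF T A] \<mu>(2) sp by (auto simp: vimage_Diff)
    then show "prob A \<le> prob (T -` A)" using le[of "UNIV - A"] A by auto
  qed (rule le[OF A])
  then have "invariant_borel_prob T \<mu>"
    using \<mu>(1,2) by (simp add: invariant_borel_prob_def emeasure_eq_measure)
  then show ?thesis using that \<mu>(4) by blast
qed

section \<open>Empirical charges of orbit segments and their limits\<close>

definition visits :: "('a \<Rightarrow> 'a) \<Rightarrow> 'a set \<Rightarrow> nat \<Rightarrow> 'a \<Rightarrow> nat" where
  "visits T A n x = card {t. t < n \<and> (T ^^ t) x \<in> A}"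

lemma visits_eq_sum: "real (visits T A n x) = (\<Sum>t<n. indicator A ((T ^^ t) x))"
proof -
  have "(\<Sum>t<n. indicator A ((T ^^ t) x) :: real) = (\<Sum>t<n. of_bool ((T ^^ t) x \<in> A))"
    by (intro sum.cong) (auto simp: indicator_def)
  also have "\<dots> = real (card ({..<n} \<inter> {t. (T ^^ t) x \<in> A}))" by (simp add: sum_of_bool_eq)
  also have "{..<n} \<inter> {t. (T ^^ t) x \<in> A} = {t. t < n \<and> (T ^^ t) x \<in> A}" by auto
  finally show ?thesis by (simp add: visits_def)
qed

lemma visits_le: "visits T A n x \<le> n"
  unfolding visits_def by (rule order_trans[OF card_mono[of "{..<n}"]]) auto

lemma visits_mono: "A \<subseteq> B \<Longrightarrow> visits T A n x \<le> visits T B n x"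
  unfolding visits_def by (intro card_mono) auto

lemma charge_empirical:
  assumes "0 < n"
  shows "charge (\<lambda>A. real (visits T A n x) / real n)"
proof -
  have "real (visits T (A \<union> B) n x) = real (visits T A n x) + real (visits T B n x)" if "A \<inter> B = {}" for A B
    unfolding visits_eq_sum sum.distrib[symmetric] using that by (intro sum.cong) (auto simp: indicator_def)
  moreover have "visits T UNIV n x = n" by (simp add: visits_def)
  ultimately show ?thesis
    using assms visits_le[of T _ n x] by (auto simp: charge_def add_divide_distrib)
qed

text \<open>The shifted sum telescopes: only the first and the last time of the segment
  contribute.\<close>

lemma visits_vimage:
  "\<bar>real (visits T (T -` A) n x) - real (visits T A n x)\<bar> \<le> 1"
proof -
  have "real (visits T (T -` A) n x) = (\<Sum>t<n. indicator A ((T ^^ Suc t) x))"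
    unfolding visits_eq_sum by (intro sum.cong) (auto simp: indicator_def)
  also have "\<dots> = (\<Sum>t<Suc n. indicator A ((T ^^ t) x)) - indicator A x"
    by (subst sum.lessThan_Suc_shift) simp
  also have "\<dots> = real (visits T A n x) + indicator A ((T ^^ n) x) - indicator A x"
    by (simp add: visits_eq_sum)
  finally show ?thesis by (auto simp: indicator_def)
qed

text \<open>A Krylov-Bogolyubov argument in which nested compact sets replace subsequences. The
  limit is only a charge and might give the intersection no mass; the dominating measure keeps mass
  \<eta> on each closed \<open>C j\<close> and, being continuous from above, on their
  intersection.\<close>

lemma exists_invariant_measure_charging:
  fixes T :: "'a::t4_space \<Rightarrow> 'a"
  assumes cpt: "compact (UNIV :: 'a set)" and T: "continuous_on UNIV T"
    and C: "\<And>j. closed (C j)" "decseq C"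
    and freq: "\<And>j N. \<exists>n>N. \<exists>x. \<eta> * real n \<le> real (visits T (C j) n x)"
  obtains \<nu> where "invariant_borel_prob T \<nu>" "\<eta> \<le> measure \<nu> (\<Inter>j. C j)"
proof -
  define F where "F k = {m. charge m \<and> (\<forall>A. \<bar>m (T -` A) - m A\<bar> \<le> 1 / real (Suc k)) \<and> (\<forall>j\<le>k. \<eta> \<le> m (C j))}" for k
  have "(\<Inter>k. F k) \<noteq> {}"
  proof (rule INT_decseq_nonempty[OF compact_charges])
    show "closed (F k)" for k
      unfolding F_def
      by (intro closed_Collect_conj closed_Collect_all closed_Collect_imp_const closed_Collect_le
        continuous_intros continuous_on_product_coordinates closed_charges)
    show "F k \<subseteq> {m. charge m}" for k by (auto simp: F_def)
    show "decseq F"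
    proof (rule decseq_SucI)
      fix k
      have "1 / real (Suc (Suc k)) \<le> 1 / real (Suc k)" by (simp add: field_simps)
      then show "F (Suc k) \<subseteq> F k" unfolding F_def using order_trans by fastforce
    qed
    fix k
    \<comment> \<open>A segment longer than \<open>k\<close> has invariance defect at most
      \<open>1 / real (Suc k)\<close>, and frequent visits to \<open>C k\<close> are visits to every
      \<open>C j\<close> with \<open>j \<le> k\<close>.\<close>
    obtain n x where n: "k < n" and x: "\<eta> * real n \<le> real (visits T (C k) n x)" using freq by blast
    define m where "m A = real (visits T A n x) / real n" for A
    have "charge m" unfolding m_def using n by (intro charge_empirical) auto
    moreover have "\<bar>m (T -` A) - m A\<bar> \<le> 1 / real (Suc k)" for A
    proof -
      have "\<bar>m (T -` A) - m A\<bar> = \<bar>real (visits T (T -` A) n x) - real (visits T A n x)\<bar> / real n"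
        by (simp add: m_def diff_divide_distrib[symmetric])
      also have "\<dots> \<le> 1 / real n" by (intro divide_right_mono visits_vimage) auto
      also have "\<dots> \<le> 1 / real (Suc k)" using n by (intro divide_left_mono) auto
      finally show ?thesis .
    qed
    moreover have "\<eta> \<le> m (C j)" if "j \<le> k" for j
    proof -
      have "\<eta> \<le> m (C k)" using x n by (simp add: m_def field_simps)
      also have "\<dots> \<le> m (C j)"
        using visits_mono[OF decseqD[OF C(2) that]] n by (simp add: m_def divide_right_mono)
      finally show ?thesis .
    qed
    ultimately have "m \<in> F k" by (simp add: F_def)
    then show "F k \<noteq> {}" by auto
  qed
  then obtain m where m: "\<And>k. m \<in> F k" by auto
  have "m (T -` A) = m A" for A
  proof -
    have "\<bar>m (T -` A) - m A\<bar> \<le> 0"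
    proof (rule field_le_epsilon)
      fix e :: real assume "0 < e"
      then obtain k where "1 / real (Suc k) < e" using nat_approx_posE by blast
      then show "\<bar>m (T -` A) - m A\<bar> \<le> 0 + e" using m[of k] by (auto simp: F_def intro: order_trans less_imp_le)
    qed
    then show ?thesis by simp
  qed
  then have "m \<in> invariant_charges T" using m[of 0] by (simp add: invariant_charges_def F_def)
  then obtain \<nu> where \<nu>: "invariant_borel_prob T \<nu>" "\<And>K. closed K \<Longrightarrow> m K \<le> measure \<nu> K"
    by (rule invariant_charge_dominated[OF cpt T]) (use that in blast)
  interpret prob_space \<nu> using \<nu> by (simp add: invariant_borel_prob_def)
  have "(\<lambda>j. measure \<nu> (C j)) \<longlonglongrightarrow> measure \<nu> (\<Inter>j. C j)"
    using \<nu>(1) C by (intro finite_Lim_measure_decseq) (auto simp: invariant_borel_prob_def)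
  moreover have "\<eta> \<le> measure \<nu> (C j)" for j
    using \<nu>(2)[OF C(1)[of j]] m[of j] by (force simp: F_def)
  ultimately have "\<eta> \<le> measure \<nu> (\<Inter>j. C j)" by (intro LIMSEQ_le_const) auto
  then show ?thesis using that \<nu>(1) by blast
qed

section \<open>Ergodic measures charging a closed set\<close>

lemma compact_countable_dense:
  assumes "compact (UNIV :: 'a::metric_space set)"
  obtains D :: "'a::metric_space set" where "countable D" "\<And>x e. 0 < e \<Longrightarrow> \<exists>y\<in>D. dist x y < e"
proof -
  have "\<exists>F :: 'a set. finite F \<and> UNIV \<subseteq> (\<Union>y\<in>F. ball y (1 / real (Suc n)))" for n
  proof -
    have "UNIV \<subseteq> (\<Union>y\<in>UNIV. ball (y::'a) (1 / real (Suc n)))"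
      by (auto intro: exI[of _ "_ :: 'a"] simp: field_simps)
    then obtain F :: "'a set" where "finite F" "UNIV \<subseteq> (\<Union>y\<in>F. ball y (1 / real (Suc n)))"
      by (rule compactE_image[OF assms, rotated]) auto
    then show ?thesis by blast
  qed
  then obtain F :: "nat \<Rightarrow> 'a set" where F: "\<And>n. finite (F n)" "\<And>n. UNIV \<subseteq> (\<Union>y\<in>F n. ball y (1 / real (Suc n)))"
    by metis
  show ?thesis
  proof (rule that[of "\<Union>n. F n"])
    show "countable (\<Union>n. F n)" using F(1) by (auto intro: countable_finite)
    fix x :: 'a and e :: real assume "0 < e"
    then obtain n where n: "1 / real (Suc n) < e" using nat_approx_posE by blast
    obtain y where "y \<in> F n" "dist y x < 1 / real (Suc n)" using F(2)[of n] by fastforce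
    then show "\<exists>y\<in>\<Union>n. F n. dist x y < e" using n by (auto simp: dist_commute intro!: bexI[of _ y])
  qed
qed

text \<open>Complements of finite unions of basic balls. They are closed, so that charges can be
  compared with dominating measures on them, and stable under intersection, so that they determine a
  probability measure.\<close>

lemma compact_countable_closed_generator:
  assumes "compact (UNIV :: 'a::metric_space set)"
  obtains \<D> :: "'a::metric_space set set" where "countable \<D>" "Int_stable \<D>" "UNIV \<in> \<D>" "\<And>K. K \<in> \<D> \<Longrightarrow> closed K"
    "sigma_sets UNIV \<D> = sets borel"
proof -
  obtain D :: "'a set" where D: "countable D" "\<And>x e. 0 < e \<Longrightarrow> \<exists>y\<in>D. dist x y < e"
    using compact_countable_dense[OF assms] by metis
  define \<B> where "\<B> = (\<lambda>(y, n). ball y (1 / real (Suc n))) ` (D \<times> UNIV)"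
  define \<D> where "\<D> = (\<lambda>F. - \<Union>F) ` {F. finite F \<and> F \<subseteq> \<B>}"
  have "countable \<B>" unfolding \<B>_def using D(1) by auto
  have openB: "open B" if "B \<in> \<B>" for B using that by (auto simp: \<B>_def)
  have base: "\<exists>B\<in>\<B>. x \<in> B \<and> B \<subseteq> U" if "open U" "x \<in> U" for x U
  proof -
    obtain e where e: "0 < e" "ball x e \<subseteq> U" using \<open>open U\<close> \<open>x \<in> U\<close> openE by blast
    obtain n where n: "1 / real (Suc n) < e / 2" using nat_approx_posE[of "e / 2"] e by auto
    obtain y where y: "y \<in> D" "dist x y < 1 / real (Suc n)" using D(2)[of "1 / real (Suc n)" x] by auto
    have "ball y (1 / real (Suc n)) \<subseteq> ball x e"
    proof
      fix z assume "z \<in> ball y (1 / real (Suc n))"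
      then show "z \<in> ball x e" using y(2) n dist_triangle[of x z y] by auto
    qed
    then have "ball y (1 / real (Suc n)) \<in> \<B> \<and> x \<in> ball y (1 / real (Suc n)) \<and> ball y (1 / real (Suc n)) \<subseteq> U"
      using y e by (auto simp: \<B>_def dist_commute)
    then show ?thesis by blast
  qed
  show ?thesis
  proof (rule that[of \<D>])
    show "countable \<D>" unfolding \<D>_def
      using countable_Collect_finite_subset[OF \<open>countable \<B>\<close>] by auto
    show "Int_stable \<D>"
    proof (rule Int_stableI)
      fix a b assume "a \<in> \<D>" "b \<in> \<D>"
      then obtain F G where "finite F" "F \<subseteq> \<B>" "a = - \<Union>F" "finite G" "G \<subseteq> \<B>" "b = - \<Union>G" by (auto simp: \<D>_def)
      then show "a \<inter> b \<in> \<D>" unfolding \<D>_def by (intro image_eqI[of _ _ "F \<union> G"]) auto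
    qed
    show "UNIV \<in> \<D>" unfolding \<D>_def by (intro image_eqI[of _ _ "{}"]) auto
    show cl: "closed K" if "K \<in> \<D>" for K
      using that openB by (auto simp: \<D>_def intro!: closed_Compl open_Union)
    show "sigma_sets UNIV \<D> = sets borel"
    proof (rule antisym)
      show "sigma_sets UNIV \<D> \<subseteq> sets borel"
        using sets.sigma_sets_subset[of \<D> borel] borel_closed[OF cl] by (simp add: subset_iff)
      interpret S: sigma_algebra UNIV "sigma_sets UNIV \<D>" by (rule sigma_algebra_sigma_sets) simp
      have B: "B \<in> sigma_sets UNIV \<D>" if "B \<in> \<B>" for B
      proof -
        have "- B \<in> \<D>" unfolding \<D>_def using that by (intro image_eqI[of _ _ "{B}"]) auto
        then have "UNIV - (- B) \<in> sigma_sets UNIV \<D>" by blast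
        then show ?thesis by (simp add: Compl_eq_Diff_UNIV[symmetric])
      qed
      have "U \<in> sigma_sets UNIV \<D>" if "open U" for U
      proof -
        have "U = \<Union>{B \<in> \<B>. B \<subseteq> U}" using base[OF that] by blast
        also have "\<dots> \<in> sigma_sets UNIV \<D>"
          using B \<open>countable \<B>\<close> by (intro S.countable_Union) (auto intro: countable_subset[of _ \<B>])
        finally show ?thesis .
      qed
      then show "sets borel \<subseteq> sigma_sets UNIV \<D>"
        unfolding sets_borel by (intro S.sigma_sets_subset) auto
    qed
  qed
qed

text \<open>Maximising \<open>D 0, D 1, \<dots>\<close> successively cuts out a decreasing sequence of compact faces of the
  convex set of invariant charges; a measure in their intersection is determined by its values on
  the \<open>D k\<close>, and so is each of its convex components.\<close>

lemma exists_lexicographic_maximal_measure: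
  fixes T :: "'a::t4_space \<Rightarrow> 'a" and D :: "nat \<Rightarrow> 'a set"
  assumes cpt: "compact (UNIV :: 'a set)" and T: "continuous_on UNIV T"
    and D: "\<And>k. closed (D k)" and \<nu>: "invariant_borel_prob T \<nu>"
  obtains \<mu> where "invariant_borel_prob T \<mu>" "measure \<nu> (D 0) \<le> measure \<mu> (D 0)"
    "\<forall>a\<in>invariant_charges T. \<forall>b\<in>invariant_charges T. \<forall>p. 0 < p \<longrightarrow> p < 1 \<longrightarrow>
       (\<forall>A\<in>sets borel. measure \<mu> A = p * a A + (1 - p) * b A) \<longrightarrow> (\<forall>k. a (D k) = measure \<mu> (D k))"
proof -
  define M where "M = rec_nat (invariant_charges T) (\<lambda>k S. {m \<in> S. \<forall>m'\<in>S. m' (D k) \<le> m (D k)})"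
  have M0: "M 0 = invariant_charges T" and
    MSuc: "M (Suc k) = {m \<in> M k. \<forall>m'\<in>M k. m' (D k) \<le> m (D k)}" for k
    by (simp_all add: M_def)
  have cl0: "closed (invariant_charges T)"
    unfolding invariant_charges_def Ball_def
    by (intro closed_Collect_conj closed_charges closed_Collect_all closed_Collect_imp_const closed_Collect_eq
        continuous_on_product_coordinates)
  have cl: "closed (M k) \<and> M k \<subseteq> invariant_charges T \<and> M k \<noteq> {}" for k
  proof (induction k)
    case 0
    show ?case using cl0 measure_in_invariant_charges[OF \<nu>] by (auto simp: M0)
  next
    case (Suc k)
    have "M (Suc k) = M k \<inter> {m. \<forall>m'\<in>M k. m' (D k) \<le> m (D k)}" by (auto simp: MSuc)
    also have "closed \<dots>"
      unfolding Ball_def using Suc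
      by (intro closed_Int closed_Collect_all closed_Collect_imp_const closed_Collect_le continuous_intros
          continuous_on_product_coordinates) auto
    finally have "closed (M (Suc k))" .
    moreover have "compact (M k)"
      using compact_Int_closed[OF compact_invariant_charges[of T], of "M k"] Suc by (metis inf.absorb2)
    then have "\<exists>m\<in>M k. \<forall>m'\<in>M k. m' (D k) \<le> m (D k)"
      using Suc by (intro continuous_attains_sup continuous_on_subset[OF continuous_on_product_coordinates]) auto
    ultimately show ?case using Suc by (auto simp: MSuc)
  qed
  have "decseq M" by (rule decseq_SucI) (auto simp: MSuc)
  then have "(\<Inter>k. M k) \<noteq> {}"
    using cl by (intro INT_decseq_nonempty[OF compact_invariant_charges[of T]]) auto
  then obtain m where m: "\<And>k. m \<in> M k" by auto
  then obtain \<mu> where \<mu>: "invariant_borel_prob T \<mu>" "\<And>K. closed K \<Longrightarrow> m K \<le> measure \<mu> K"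
    using invariant_charge_dominated[OF cpt T] M0 by metis
  have \<mu>M: "measure \<mu> \<in> M k" for k
  proof (induction k)
    case 0
    show ?case using measure_in_invariant_charges[OF \<mu>(1)] by (simp add: M0)
  next
    case (Suc k)
    \<comment> \<open>\<open>m\<close> already attains the maximum over \<open>M k\<close>, and
      \<mu> is at least \<open>m\<close> on the closed set \<open>D k\<close>; so the regularised
      measure does not leave the face.\<close>
    have "m' (D k) \<le> measure \<mu> (D k)" if "m' \<in> M k" for m'
      using m[of "Suc k"] that \<mu>(2)[OF D, of k] by (force simp: MSuc)
    with Suc show ?case by (simp add: MSuc)
  qed
  show ?thesis
  proof (rule that[OF \<mu>(1)])
    show "measure \<nu> (D 0) \<le> measure \<mu> (D 0)"
      using \<mu>M[of 1] measure_in_invariant_charges[OF \<nu>] by (simp add: MSuc M0)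
    show "\<forall>a\<in>invariant_charges T. \<forall>b\<in>invariant_charges T. \<forall>p. 0 < p \<longrightarrow> p < 1 \<longrightarrow>
       (\<forall>A\<in>sets borel. measure \<mu> A = p * a A + (1 - p) * b A) \<longrightarrow> (\<forall>k. a (D k) = measure \<mu> (D k))"
    proof (intro ballI allI impI)
      fix a b and p :: real and k
      assume ab: "a \<in> invariant_charges T" "b \<in> invariant_charges T" and p: "0 < p" "p < 1"
        and eq: "\<forall>A\<in>sets borel. measure \<mu> A = p * a A + (1 - p) * b A"
      have *: "a (D k) = measure \<mu> (D k) \<and> b (D k) = measure \<mu> (D k)" if "a \<in> M k" "b \<in> M k" for k
      proof -
        have le: "a (D k) \<le> measure \<mu> (D k)" "b (D k) \<le> measure \<mu> (D k)"
          using \<mu>M[of "Suc k"] that by (auto simp: MSuc)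
        \<comment> \<open>A proper convex combination of two values that do not exceed the maximum
          equals the maximum only if both do.\<close>
        have "p * (measure \<mu> (D k) - a (D k)) + (1 - p) * (measure \<mu> (D k) - b (D k)) = 0"
          using bspec[OF eq, of "D k"] D[of k] by (auto simp: algebra_simps)
        moreover have "0 \<le> p * (measure \<mu> (D k) - a (D k))" "0 \<le> (1 - p) * (measure \<mu> (D k) - b (D k))"
          using le p by simp_all
        ultimately show ?thesis using p by (simp add: add_nonneg_eq_0_iff)
      qed
      have "a \<in> M k \<and> b \<in> M k" for k
      proof (induction k)
        case 0
        show ?case using ab by (simp add: M0)
      next
        case (Suc k)
        then show ?case using *[of k] \<mu>M[of "Suc k"] by (auto simp: MSuc)
      qed
      then show "a (D k) = measure \<mu> (D k)" using * by blast
    qed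
  qed
qed

text \<open>Exact invariance of \<open>A\<close> makes intersecting with \<open>A\<close> commute
  with taking preimages. The conclusion is phrased for charges, the class over which the
  lexicographic maxima are taken.\<close>

lemma invariant_conditional_charge:
  assumes \<mu>: "invariant_borel_prob T \<mu>" and T: "continuous_on UNIV T"
    and A: "A \<in> sets borel" "T -` A = A" "measure \<mu> A \<noteq> 0"
  shows "(\<lambda>B. measure \<mu> (A \<inter> B) / measure \<mu> A) \<in> invariant_charges T"
proof -
  interpret prob_space \<mu> using \<mu> by (simp add: invariant_borel_prob_def)
  have [simp]: "sets \<mu> = sets borel" using \<mu> by (simp add: invariant_borel_prob_def)
  have inv: "measure \<mu> (T -` B) = measure \<mu> B" if "B \<in> sets borel" for B
    using measure_in_invariant_charges[OF \<mu>] that by (simp add: invariant_charges_def)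
  have pos: "measure \<mu> A > 0" using A(3) by (simp add: zero_less_measure_iff)
  show ?thesis
    unfolding invariant_charges_def charge_def mem_Collect_eq
  proof (intro conjI allI ballI impI)
    fix B
    show "0 \<le> measure \<mu> (A \<inter> B) / measure \<mu> A" by simp
    show "measure \<mu> (A \<inter> B) / measure \<mu> A \<le> 1"
      using pos A(1) by (simp add: finite_measure_mono)
    show "measure \<mu> (A \<inter> UNIV) / measure \<mu> A = 1" using pos by simp
  next
    fix B C :: "'a set" assume "B \<in> sets borel" "C \<in> sets borel" "B \<inter> C = {}"
    then have "measure \<mu> ((A \<inter> B) \<union> (A \<inter> C)) = measure \<mu> (A \<inter> B) + measure \<mu> (A \<inter> C)"
      using A by (intro finite_measure_Union) auto
    then show "measure \<mu> (A \<inter> (B \<union> C)) / measure \<mu> A = measure \<mu> (A \<inter> B) / measure \<mu> A + measure \<mu> (A \<inter> C) / measure \<mu> A"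
      by (simp add: Int_Un_distrib add_divide_distrib)
  next
    fix B :: "'a set" assume "B \<in> sets borel"
    then show "measure \<mu> (A \<inter> T -` B) / measure \<mu> A = measure \<mu> (A \<inter> B) / measure \<mu> A"
      using inv[of "A \<inter> B"] A by simp
  qed
qed

text \<open>Giving \<open>\<Inter>j. C j\<close> the first priority preserves its mass \<eta>; the
  later priorities run through a generator and pin the measure down. An invariant set
  \<open>A\<close> of intermediate mass would split \<mu> into its two conditionings, so \<mu> would
  coincide with its conditioning on \<open>A\<close>, which gives \<open>A\<close> mass 1.\<close>

theorem exists_ergodic_measure_charging:
  fixes T :: "'a::metric_space \<Rightarrow> 'a"
  assumes cpt: "compact (UNIV :: 'a set)" and T: "continuous_on UNIV T"
    and C: "\<And>j. closed (C j)" "decseq C"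
    and freq: "\<And>j N. \<exists>n>N. \<exists>x. \<eta> * real n \<le> real (visits T (C j) n x)"
  obtains \<mu> where "\<mu> \<in> ergodic_measures T" "\<eta> \<le> measure \<mu> (\<Inter>j. C j)"
proof -
  obtain \<nu> where \<nu>: "invariant_borel_prob T \<nu>" "\<eta> \<le> measure \<nu> (\<Inter>j. C j)"
    by (rule exists_invariant_measure_charging[OF cpt T C freq])
  obtain \<D> :: "'a set set" where \<D>: "countable \<D>" "Int_stable \<D>" "UNIV \<in> \<D>" "\<And>K. K \<in> \<D> \<Longrightarrow> closed K"
    "sigma_sets UNIV \<D> = sets borel"
    using compact_countable_closed_generator[OF cpt] by metis
  define D where "D k = (case k of 0 \<Rightarrow> \<Inter>j. C j | Suc k \<Rightarrow> from_nat_into \<D> k)" for k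
  have D: "closed (D k)" for k
    using C(1) \<D>(3,4) from_nat_into[of \<D>] by (auto simp: D_def split: nat.split)
  obtain \<mu> where \<mu>: "invariant_borel_prob T \<mu>" "measure \<nu> (D 0) \<le> measure \<mu> (D 0)"
    and ext: "\<forall>a\<in>invariant_charges T. \<forall>b\<in>invariant_charges T. \<forall>p. 0 < p \<longrightarrow> p < 1 \<longrightarrow>
       (\<forall>A\<in>sets borel. measure \<mu> A = p * a A + (1 - p) * b A) \<longrightarrow> (\<forall>k. a (D k) = measure \<mu> (D k))"
    by (rule exists_lexicographic_maximal_measure[OF cpt T D \<nu>(1)])
  interpret prob_space \<mu> using \<mu> by (simp add: invariant_borel_prob_def)
  have [simp]: "sets \<mu> = sets borel" using \<mu> by (simp add: invariant_borel_prob_def)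
  have [simp]: "space \<mu> = UNIV" using sets_eq_imp_space_eq[OF \<open>sets \<mu> = sets borel\<close>] by simp
  have "measure \<mu> A = 0 \<or> measure \<mu> A = 1" if A: "A \<in> sets borel" "T -` A = A" for A
  proof (rule ccontr)
    assume "\<not> ?thesis"
    then have p: "0 < measure \<mu> A" "measure \<mu> A < 1" using prob_le_1[of A] by (auto simp: zero_less_measure_iff simp del: prob_le_1)
    have compl: "measure \<mu> (- A) = 1 - measure \<mu> A" using prob_compl[of A] A by (simp add: Compl_eq_Diff_UNIV)
    have [simp]: "T -` (- A) = - A" using A(2) by auto
    define a where "a B = measure \<mu> (A \<inter> B) / measure \<mu> A" for B
    define b where "b B = measure \<mu> (- A \<inter> B) / measure \<mu> (- A)" for B
    have a: "a \<in> invariant_charges T" unfolding a_def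
      using p A by (intro invariant_conditional_charge[OF \<mu>(1) T]) auto
    have b: "b \<in> invariant_charges T" unfolding b_def
      using p A compl by (intro invariant_conditional_charge[OF \<mu>(1) T]) auto
    have "measure \<mu> B = measure \<mu> A * a B + (1 - measure \<mu> A) * b B" if "B \<in> sets borel" for B
    proof -
      have "measure \<mu> ((A \<inter> B) \<union> (- A \<inter> B)) = measure \<mu> (A \<inter> B) + measure \<mu> (- A \<inter> B)"
        using that A by (intro finite_measure_Union) auto
      moreover have "(A \<inter> B) \<union> (- A \<inter> B) = B" by auto
      ultimately show ?thesis using p by (simp add: a_def b_def compl)
    qed
    then have aD: "a (D k) = measure \<mu> (D k)" for k
      using ext a b p by blast
    have a_eq: "measure (uniform_measure \<mu> A) B = a B" if "B \<in> sets borel" for B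
      using that p by (simp add: a_def emeasure_eq_measure)
    have "prob_space (uniform_measure \<mu> A)"
      using p by (intro prob_space_uniform_measure) (auto simp: emeasure_eq_measure)
    then interpret U: prob_space "uniform_measure \<mu> A" .
    have "uniform_measure \<mu> A = \<mu>"
    proof (rule measure_eqI_generator_eq[OF \<D>(2), where A = "\<lambda>_. UNIV" and \<Omega> = UNIV])
      fix X assume X: "X \<in> \<D>"
      have "X = D (Suc (to_nat_on \<D> X))" using X \<D>(1) by (simp add: D_def)
      then have "a X = measure \<mu> X" using aD by metis
      then show "emeasure (uniform_measure \<mu> A) X = emeasure \<mu> X"
        using a_eq[of X] \<D>(4)[OF X] by (simp add: U.emeasure_eq_measure emeasure_eq_measure del: measure_uniform_measure emeasure_uniform_measure)
    qed (use \<D> in auto)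
    then have "a A = measure \<mu> A" using a_eq[OF A(1)] by simp
    then show False using p by (simp add: a_def)
  qed
  then have "\<mu> \<in> ergodic_measures T" using \<mu>(1) by (simp add: ergodic_measures_def)
  moreover have "\<eta> \<le> measure \<mu> (\<Inter>j. C j)" using \<nu>(2) \<mu>(2) by (simp add: D_def)
  ultimately show ?thesis using that by blast
qed

section \<open>Bowen covers and tilings\<close>

lemma bowen_dist_less_iff: "0 < n \<Longrightarrow> bowen_dist T n x y < e \<longleftrightarrow> (\<forall>k<n. dist ((T ^^ k) x) ((T ^^ k) y) < e)"
  unfolding bowen_dist_def by (subst Max_less_iff) auto

lemma bowen_dist_le_iff: "0 < n \<Longrightarrow> bowen_dist T n x y \<le> e \<longleftrightarrow> (\<forall>k<n. dist ((T ^^ k) x) ((T ^^ k) y) \<le> e)"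
  unfolding bowen_dist_def by (subst Max_le_iff) auto

lemma bowen_dist_commute: "bowen_dist T n x y = bowen_dist T n y x"
  unfolding bowen_dist_def by (simp add: dist_commute)

lemma dist_le_bowen_dist: "k < n \<Longrightarrow> dist ((T ^^ k) x) ((T ^^ k) y) \<le> bowen_dist T n x y"
  using bowen_dist_le_iff[of n T x y] by auto

lemma bowen_dist_triangle:
  assumes "0 < n"
  shows "bowen_dist T n x z \<le> bowen_dist T n x y + bowen_dist T n y z"
  unfolding bowen_dist_le_iff[OF assms]
proof (intro allI impI)
  fix k assume "k < n"
  have "dist ((T ^^ k) x) ((T ^^ k) z) \<le> dist ((T ^^ k) x) ((T ^^ k) y) + dist ((T ^^ k) y) ((T ^^ k) z)"
    by (rule dist_triangle)
  also have "\<dots> \<le> bowen_dist T n x y + bowen_dist T n y z"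
    using \<open>k < n\<close> by (intro add_mono dist_le_bowen_dist)
  finally show "dist ((T ^^ k) x) ((T ^^ k) z) \<le> bowen_dist T n x y + bowen_dist T n y z" .
qed

lemma bowen_dist_refl: "0 < n \<Longrightarrow> bowen_dist T n x x = 0"
  unfolding bowen_dist_def by (simp add: image_constant_conv lessThan_empty_iff)

text \<open>Stated time by time rather than through \<open>bowen_dist\<close>, which is a maximum
  over the empty set at \<open>n = 0\<close>. Here every set is small at \<open>n = 0\<close>, which
  gives the inductions on length a base case.\<close>

definition bowen_small :: "('a::metric_space \<Rightarrow> 'a) \<Rightarrow> real \<Rightarrow> nat \<Rightarrow> 'a set \<Rightarrow> bool" where
  "bowen_small T r n U \<longleftrightarrow> (\<forall>x\<in>U. \<forall>y\<in>U. \<forall>k<n. dist ((T ^^ k) x) ((T ^^ k) y) \<le> r)"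

lemma bowen_smallD: "\<lbrakk>bowen_small T r n U; x \<in> U; y \<in> U; k < n\<rbrakk> \<Longrightarrow> dist ((T ^^ k) x) ((T ^^ k) y) \<le> r"
  by (simp add: bowen_small_def)

text \<open>The bound \<open>c\<close> is real because it will be a product or sum of
  exponentials.\<close>

definition bowen_cover :: "('a::metric_space \<Rightarrow> 'a) \<Rightarrow> real \<Rightarrow> nat \<Rightarrow> 'a set \<Rightarrow> real \<Rightarrow> bool" where
  "bowen_cover T r n A c \<longleftrightarrow> (\<exists>\<C>. finite \<C> \<and> real (card \<C>) \<le> c \<and> A \<subseteq> \<Union>\<C> \<and>
     (\<forall>U\<in>\<C>. bowen_small T r n U))"

lemma bowen_cover_mono: "bowen_cover T r n B c \<Longrightarrow> A \<subseteq> B \<Longrightarrow> c \<le> d \<Longrightarrow> bowen_cover T r n A d"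
  unfolding bowen_cover_def by (meson order_trans)

lemma bowen_cover_empty: "0 \<le> c \<Longrightarrow> bowen_cover T r n {} c"
  unfolding bowen_cover_def by (intro exI[of _ "{}"]) auto

lemma bowen_cover_UN:
  assumes "finite I" "\<And>i. i \<in> I \<Longrightarrow> bowen_cover T r n (A i) (c i)"
  shows "bowen_cover T r n (\<Union>i\<in>I. A i) (\<Sum>i\<in>I. c i)"
proof -
  obtain \<C> where \<C>: "\<And>i. i \<in> I \<Longrightarrow> finite (\<C> i) \<and> real (card (\<C> i)) \<le> c i \<and> A i \<subseteq> \<Union>(\<C> i) \<and>
     (\<forall>U\<in>\<C> i. bowen_small T r n U)"
    using assms(2) unfolding bowen_cover_def by metis
  have "real (card (\<Union>i\<in>I. \<C> i)) \<le> (\<Sum>i\<in>I. real (card (\<C> i)))"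
    using card_UN_le[OF assms(1), of \<C>] by (metis of_nat_le_iff of_nat_sum)
  also have "\<dots> \<le> (\<Sum>i\<in>I. c i)" using \<C> by (intro sum_mono) auto
  finally show ?thesis
    unfolding bowen_cover_def using \<C> assms(1) by (intro exI[of _ "\<Union>i\<in>I. \<C> i"]) fastforce
qed

lemma bowen_cover_Un:
  assumes "bowen_cover T r n A c" "bowen_cover T r n B d"
  shows "bowen_cover T r n (A \<union> B) (c + d)"
proof -
  have "bowen_cover T r n (\<Union>b\<in>UNIV. if b then A else B) (\<Sum>b\<in>UNIV. if b then c else d)"
    using assms by (intro bowen_cover_UN) auto
  then show ?thesis by (simp add: UNIV_bool Un_commute add.commute)
qed

text \<open>The joint refinement of one cover with the preimage of the other: times below
  \<open>n\<close> are controlled by the first set, later times by the second.\<close>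

lemma bowen_cover_concat:
  assumes "bowen_cover T r n A c" "bowen_cover T r m B d"
  shows "bowen_cover T r (n + m) (A \<inter> (T ^^ n) -` B) (c * d)"
proof -
  obtain \<C> where \<C>: "finite \<C>" "real (card \<C>) \<le> c" "A \<subseteq> \<Union>\<C>"
     "\<forall>U\<in>\<C>. bowen_small T r n U"
    using assms(1) unfolding bowen_cover_def by blast
  obtain \<D> where \<D>: "finite \<D>" "real (card \<D>) \<le> d" "B \<subseteq> \<Union>\<D>"
     "\<forall>U\<in>\<D>. bowen_small T r m U"
    using assms(2) unfolding bowen_cover_def by blast
  let ?E = "(\<lambda>(U, V). U \<inter> (T ^^ n) -` V) ` (\<C> \<times> \<D>)"
  have "card ?E \<le> card \<C> * card \<D>"
    using card_image_le[of "\<C> \<times> \<D>"] \<C>(1) \<D>(1) by (simp add: card_cartesian_product)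
  then have "real (card ?E) \<le> real (card \<C>) * real (card \<D>)" by (metis of_nat_le_iff of_nat_mult)
  also have "\<dots> \<le> c * d" using \<C>(2) \<D>(2) by (intro mult_mono) auto
  finally have card: "real (card ?E) \<le> c * d" .
  have "A \<inter> (T ^^ n) -` B \<subseteq> \<Union>?E" using \<C>(3) \<D>(3) by fastforce
  moreover have "dist ((T ^^ k) x) ((T ^^ k) y) \<le> r"
    if "U \<in> \<C>" "V \<in> \<D>" "x \<in> U" "y \<in> U" "(T ^^ n) x \<in> V" "(T ^^ n) y \<in> V" "k < n + m" for U V x y k
  proof (cases "k < n")
    case False
    then have "(T ^^ k) z = (T ^^ (k - n)) ((T ^^ n) z)" for z
      by (metis add.commute add_diff_inverse_nat comp_apply funpow_add)
    then show ?thesis using bowen_smallD[of T r m V "(T ^^ n) x" "(T ^^ n) y" "k - n"] \<D>(4) that False by simp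
  qed (use \<C>(4) that bowen_smallD[of T r n U x y k] in auto)
  ultimately show ?thesis
    unfolding bowen_cover_def using card \<C>(1) \<D>(1) by (intro exI[of _ ?E]) (auto simp: bowen_small_def)
qed

lemma bowen_cover_power:
  assumes "bowen_cover T r 1 UNIV K"
  shows "bowen_cover T r n UNIV (K ^ n)"
proof (induction n)
  case 0
  show ?case unfolding bowen_cover_def by (intro exI[of _ "{UNIV}"]) (auto simp: bowen_small_def)
next
  case (Suc n)
  then show ?case using bowen_cover_concat[OF assms Suc] by simp
qed

lemma exists_bowen_cover_1:
  fixes T :: "'a::metric_space \<Rightarrow> 'a"
  assumes "compact (UNIV :: 'a set)" "0 < r"
  obtains K where "1 \<le> K" "bowen_cover T r 1 UNIV K"
proof -
  have "UNIV \<subseteq> (\<Union>y\<in>UNIV. ball (y::'a) (r / 2))" using \<open>0 < r\<close> by (auto intro: exI[of _ "_ :: 'a"])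
  then obtain F :: "'a set" where F: "finite F" "UNIV \<subseteq> (\<Union>y\<in>F. ball y (r / 2))"
    by (rule compactE_image[OF assms(1), rotated]) auto
  have "dist x y \<le> r" if "x \<in> ball z (r / 2)" "y \<in> ball z (r / 2)" for x y z :: 'a
    using that dist_triangle2[of x y z] by (auto simp: dist_commute)
  \<comment> \<open>The added 1 secures \<open>1 \<le> K\<close> without counting the balls.\<close>
  then have "bowen_cover T r 1 UNIV (1 + real (card ((\<lambda>y. ball y (r / 2)) ` F)))"
    unfolding bowen_cover_def using F by (intro exI[of _ "(\<lambda>y. ball y (r / 2)) ` F"]) (auto simp: bowen_small_def)
  then show ?thesis using that[of "1 + real (card ((\<lambda>y. ball y (r / 2)) ` F))"] by simp
qed

lemma bowen_cover_bowen_balls: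
  assumes "finite F" "0 < n"
  shows "bowen_cover T (2 * e) n (\<Union>y\<in>F. bowen_ball T n y e) (real (card F))"
proof -
  have "dist ((T ^^ k) x) ((T ^^ k) y) \<le> 2 * e" if "x \<in> bowen_ball T n z e" "y \<in> bowen_ball T n z e" "k < n" for x y z k
    using that dist_triangle2[of "(T ^^ k) x" "(T ^^ k) y" "(T ^^ k) z"]
    by (simp add: bowen_ball_def bowen_dist_less_iff[OF \<open>0 < n\<close>] dist_commute) (smt (verit) dist_commute)
  moreover have "card ((\<lambda>y. bowen_ball T n y e) ` F) \<le> card F" by (rule card_image_le[OF assms(1)])
  ultimately show ?thesis
    unfolding bowen_cover_def using assms by (intro exI[of _ "(\<lambda>y. bowen_ball T n y e) ` F"]) (auto simp: bowen_small_def)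
qed

text \<open>Pigeonhole: separation is strict while the sets of the cover have diameter at most
  \<open>r\<close>, so each contains at most one point of \<open>E\<close>.\<close>

lemma separated_card_le:
  assumes "bowen_cover T r n A c" "0 < n" "E \<subseteq> A" "separated T n r E"
  shows "real (card E) \<le> c"
proof -
  obtain \<C> where \<C>: "finite \<C>" "real (card \<C>) \<le> c" "A \<subseteq> \<Union>\<C>"
     "\<forall>U\<in>\<C>. bowen_small T r n U"
    using assms(1) unfolding bowen_cover_def by blast
  have "\<forall>x\<in>E. \<exists>U\<in>\<C>. x \<in> U" using \<C>(3) assms(3) by blast
  then obtain f where f: "\<And>x. x \<in> E \<Longrightarrow> f x \<in> \<C> \<and> x \<in> f x" by metis
  have "inj_on f E"
  proof (rule inj_onI, rule ccontr)
    fix x y assume xy: "x \<in> E" "y \<in> E" "f x = f y" "x \<noteq> y"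
    then have "bowen_dist T n x y \<le> r"
      using f[of x] f[of y] \<C>(4) bowen_smallD[of T r n "f x" x y] by (auto simp: bowen_dist_le_iff[OF \<open>0 < n\<close>])
    moreover have "r < bowen_dist T n x y"
      using assms(4) xy unfolding separated_def by blast
    ultimately show False by simp
  qed
  then have "card E \<le> card \<C>" using f \<C>(1) by (intro card_inj_on_le[of f]) auto
  then show ?thesis using \<C>(2) by linarith
qed

lemma exists_maximal_separated:
  assumes bnd: "\<And>E. finite E \<Longrightarrow> E \<subseteq> A \<Longrightarrow> separated T n e E \<Longrightarrow> card E \<le> N" and "0 < n" "0 \<le> e"
  obtains E where "finite E" "E \<subseteq> A" "separated T n e E" "\<And>x. x \<in> A \<Longrightarrow> \<exists>y\<in>E. bowen_dist T n y x \<le> e"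
proof -
  let ?P = "\<lambda>E. finite E \<and> E \<subseteq> A \<and> separated T n e E"
  have "?P {}" by (simp add: separated_def)
  moreover have "\<forall>E. ?P E \<longrightarrow> card E < Suc N" using bnd by (auto simp: less_Suc_eq_le)
  ultimately obtain E where E: "?P E" and max: "\<And>F. ?P F \<Longrightarrow> card F \<le> card E"
    using ex_has_greatest_nat[of ?P "{}" card "Suc N"] by auto
  have "\<exists>y\<in>E. bowen_dist T n y x \<le> e" if x: "x \<in> A" for x
  proof (rule ccontr)
    assume neg: "\<not> ?thesis"
    then have "x \<notin> E" using bowen_dist_refl[OF \<open>0 < n\<close>] \<open>0 \<le> e\<close> by metis
    have far: "e < bowen_dist T n y x" "e < bowen_dist T n x y" if "y \<in> E" for y
      using neg that bowen_dist_commute[of T n x y] by auto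
    have "separated T n e (insert x E)"
      using E unfolding separated_def by (intro ballI impI) (metis far insertE)
    then have "card (insert x E) \<le> card E" using E x by (intro max) simp
    then show False using E \<open>x \<notin> E\<close> by simp
  qed
  then show ?thesis using that E by blast
qed

text \<open>A cover bounds the cardinalities, so the \<open>Max\<close> in \<open>sep_number\<close>
  ranges over a finite nonempty set and has its intended meaning. The lower bound 1, from a
  singleton, keeps later logarithms away from \<open>ln 0\<close>.\<close>

lemma sep_number_le:
  assumes "bowen_cover T r n UNIV c" "0 < n"
  shows "real (sep_number T n UNIV r) \<le> c"
    and "1 \<le> sep_number T n UNIV r"
    and "\<And>E. finite E \<Longrightarrow> separated T n r E \<Longrightarrow> card E \<le> sep_number T n UNIV r"
proof -
  let ?S = "{card E |E. E \<subseteq> UNIV \<and> finite E \<and> separated T n r E}"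
  have "k \<le> nat \<lfloor>c\<rfloor>" if "k \<in> ?S" for k
    using that separated_card_le[OF assms(1,2)] by (auto simp: le_nat_floor)
  then have fin: "finite ?S" by (meson finite_nat_set_iff_bounded_le)
  have mem: "card E \<in> ?S" if "finite E" "separated T n r E" for E
    using that by auto
  have "separated T n r {}" by (simp add: separated_def)
  then have "sep_number T n UNIV r \<in> ?S"
    unfolding sep_number_def using fin mem[of "{}"] by (intro Max_in) auto
  then show "real (sep_number T n UNIV r) \<le> c" using separated_card_le[OF assms(1,2)] by auto
  show *: "\<And>E. finite E \<Longrightarrow> separated T n r E \<Longrightarrow> card E \<le> sep_number T n UNIV r"
    unfolding sep_number_def using fin mem by (intro Max_ge) auto
  show "1 \<le> sep_number T n UNIV r" using *[of "{undefined}"] by (simp add: separated_def)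
qed

section \<open>Visits along shifted orbits and the count of tilings\<close>

lemma visits_Suc: "visits T A (Suc n) x = (if x \<in> A then 1 else 0) + visits T A n (T x)"
proof -
  have "real (visits T A (Suc n) x) = real ((if x \<in> A then 1 else 0) + visits T A n (T x))"
    unfolding of_nat_add visits_eq_sum by (subst sum.lessThan_Suc_shift) (simp add: funpow_swap1)
  then show ?thesis by (rule of_nat_eq_iff[THEN iffD1])
qed

lemma visits_shift_le: "visits T A m ((T ^^ n) x) \<le> visits T A (n + m) x"
proof (induction n arbitrary: x)
  case (Suc n)
  have "visits T A m ((T ^^ Suc n) x) = visits T A m ((T ^^ n) (T x))"
    by (simp add: funpow_swap1)
  also have "\<dots> \<le> visits T A (n + m) (T x)" by (rule Suc)
  also have "\<dots> \<le> visits T A (Suc n + m) x" by (simp add: visits_Suc)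
  finally show ?case .
qed simp

text \<open>An orbit segment is read greedily from the left: at a time when the orbit is in \<open>G n\<close> a block of
  length \<open>n\<close> is cut off, at all other times a single step. Each such exceptional step costs a factor
  \<open>K\<close>; the factor \<open>2\<close> together with the bound on the exponential sum makes the induction close.\<close>

lemma bowen_cover_tiling:
  fixes T :: "'a::metric_space \<Rightarrow> 'a"
  assumes K: "1 \<le> K" "bowen_cover T r 1 UNIV K" and "0 \<le> a" "0 \<le> \<delta>"
    and I: "finite I" "0 \<notin> I" "(\<Sum>n\<in>I. exp (- \<delta> * real n)) \<le> 1 / 2"
    and G: "\<And>n. n \<in> I \<Longrightarrow> bowen_cover T r n (G n) (exp (a * real n))"
  shows "\<exists>C\<ge>1. \<forall>M q. bowen_cover T r M {y. visits T (- (\<Union>n\<in>I. G n)) M y \<le> q}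
    (C * exp ((a + \<delta>) * real M) * (2 * K) ^ q)"
proof -
  let ?B = "- (\<Union>n\<in>I. G n)"
  define P where "P = Max (insert 0 I)"
  have P: "n \<le> P" if "n \<in> I" for n using I(1) that by (simp add: P_def)
  \<comment> \<open>\<open>P\<close> bounds the block lengths. A remainder of length at most
    \<open>P\<close> may be too short for a block and is covered crudely, at a cost of at most
    \<open>K ^ P\<close>.\<close>
  define C where "C = K ^ P"
  have "1 \<le> C" using K by (simp add: C_def)
  define S where "S M q = {y. visits T ?B M y \<le> q}" for M q
  have "bowen_cover T r M (S M q) (C * exp ((a + \<delta>) * real M) * (2 * K) ^ q)" for M q
  proof (induction M arbitrary: q rule: less_induct)
    case (less M)
    show ?case
    proof (cases "M \<le> P")
      case True
      have "K ^ M \<le> C * (1 * 1)" using K True by (simp add: C_def power_increasing)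
      also have "\<dots> \<le> C * (exp ((a + \<delta>) * real M) * (2 * K) ^ q)"
        using K \<open>1 \<le> C\<close> assms(3,4) by (intro mult_left_mono mult_mono one_le_power) auto
      finally show ?thesis
        by (intro bowen_cover_mono[OF bowen_cover_power[OF K(2)]]) (auto simp: mult.assoc)
    next
      case False
      let ?c = "C * exp ((a + \<delta>) * real M) * (2 * K) ^ q"
      have c0: "0 \<le> ?c" using \<open>1 \<le> C\<close> K by simp
      have "bowen_cover T r M (G n \<inter> (T ^^ n) -` S (M - n) q) (?c * exp (- \<delta> * real n))" if "n \<in> I" for n
      proof -
        have n: "0 < n" "n < M" using that I(2) P[OF that] False by (cases n; auto)+
        \<comment> \<open>The block itself costs only the rate \<open>a\<close>, so cutting it off
          gains \<open>exp (- \<delta> * real n)\<close>. Summed over \<open>I\<close> these gains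
          leave half of the bound for the exceptional step.\<close>
        have eq: "exp (a * real n) * exp ((a + \<delta>) * real (M - n)) = exp ((a + \<delta>) * real M) * exp (- \<delta> * real n)"
          using n by (simp add: of_nat_diff algebra_simps flip: exp_add)
        have "exp (a * real n) * (C * exp ((a + \<delta>) * real (M - n)) * (2 * K) ^ q)
            = C * (exp (a * real n) * exp ((a + \<delta>) * real (M - n))) * (2 * K) ^ q"
          by (simp only: mult_ac)
        also have "\<dots> = ?c * exp (- \<delta> * real n)" unfolding eq by (simp only: mult_ac)
        finally have eq': "exp (a * real n) * (C * exp ((a + \<delta>) * real (M - n)) * (2 * K) ^ q) = ?c * exp (- \<delta> * real n)" .
        have "bowen_cover T r (n + (M - n)) (G n \<inter> (T ^^ n) -` S (M - n) q)
            (exp (a * real n) * (C * exp ((a + \<delta>) * real (M - n)) * (2 * K) ^ q))"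
          using n by (intro bowen_cover_concat G that less) auto
        then have "bowen_cover T r (n + (M - n)) (G n \<inter> (T ^^ n) -` S (M - n) q) (?c * exp (- \<delta> * real n))"
          unfolding eq' .
        then show ?thesis using n by (simp only: le_add_diff_inverse less_imp_le)
      qed
      then have 1: "bowen_cover T r M (\<Union>n\<in>I. G n \<inter> (T ^^ n) -` S (M - n) q) (\<Sum>n\<in>I. ?c * exp (- \<delta> * real n))"
        by (intro bowen_cover_UN I(1)) auto
      have "(\<Sum>n\<in>I. ?c * exp (- \<delta> * real n)) \<le> ?c * (1 / 2)"
        unfolding sum_distrib_left[symmetric] using c0 I(3) by (intro mult_left_mono) auto
      then have 1: "bowen_cover T r M (\<Union>n\<in>I. G n \<inter> (T ^^ n) -` S (M - n) q) (?c / 2)"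
        using 1 by (auto intro: bowen_cover_mono)
      \<comment> \<open>Points starting with an exceptional step: it uses up one unit of
        \<open>q\<close>, so none exist for \<open>q = 0\<close>. The released factor
        \<open>2 * K\<close> pays \<open>K\<close> for the step and leaves the other half of the
        bound.\<close>
      define Q where "Q = (if q = 0 then {} else (T ^^ 1) -` S (M - 1) (q - 1))"
      have 2: "bowen_cover T r M Q (?c / 2)"
      proof (cases "q = 0")
        case True
        then show ?thesis using c0 by (simp add: Q_def bowen_cover_empty)
      next
        case q: False
        have "bowen_cover T r (1 + (M - 1)) (UNIV \<inter> (T ^^ 1) -` S (M - 1) (q - 1))
           (K * (C * exp ((a + \<delta>) * real (M - 1)) * (2 * K) ^ (q - 1)))"
          using False by (intro bowen_cover_concat K less) auto
        moreover have "K * (C * exp ((a + \<delta>) * real (M - 1)) * (2 * K) ^ (q - 1)) \<le> ?c / 2"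
        proof -
          have "K * (C * exp ((a + \<delta>) * real (M - 1)) * (2 * K) ^ (q - 1)) = C * exp ((a + \<delta>) * real (M - 1)) * (2 * K) ^ q / 2"
            using q by (cases q) auto
          also have "\<dots> \<le> ?c / 2"
            using \<open>1 \<le> C\<close> K assms(3,4)
            by (intro divide_right_mono mult_right_mono mult_left_mono) (auto intro!: mult_left_mono)
          finally show ?thesis .
        qed
        ultimately show ?thesis using q False by (auto simp: Q_def intro: bowen_cover_mono)
      qed
      have "S M q \<subseteq> (\<Union>n\<in>I. G n \<inter> (T ^^ n) -` S (M - n) q) \<union> Q"
      proof
        fix y assume y: "y \<in> S M q"
        show "y \<in> (\<Union>n\<in>I. G n \<inter> (T ^^ n) -` S (M - n) q) \<union> Q"
        proof (cases "y \<in> ?B")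
          case True
          have "visits T ?B M y = Suc (visits T ?B (M - 1) (T y))"
            using visits_Suc[of T ?B "M - 1" y] True False by (cases M) auto
          then show ?thesis using y by (auto simp: S_def Q_def)
        next
          case yB: False
          then obtain n where n: "n \<in> I" "y \<in> G n" by auto
          then have "n \<le> M" using P[of n] False by auto
          then have "visits T ?B (M - n) ((T ^^ n) y) \<le> visits T ?B M y"
            using visits_shift_le[of T ?B "M - n" n y] by simp
          then show ?thesis using n y by (auto simp: S_def)
        qed
      qed
      then show ?thesis using bowen_cover_mono[OF bowen_cover_Un[OF 1 2]] by auto
    qed
  qed
  with \<open>1 \<le> C\<close> show ?thesis unfolding S_def by blast
qed

section \<open>Brin-Katok local entropy\<close>

locale compact_system =
  fixes T :: "'a::metric_space \<Rightarrow> 'a"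
  assumes compact_UNIV: "compact (UNIV :: 'a set)" and continuous_T: "continuous_on UNIV T"
begin

section \<open>Bowen balls and measurability of their mass\<close>

lemma continuous_funpow: "continuous_on UNIV (T ^^ n)"
proof (induction n)
  case (Suc n)
  have "continuous_on UNIV (T \<circ> (T ^^ n))"
    using Suc by (rule continuous_on_compose) (rule continuous_on_subset[OF continuous_T], simp)
  then show ?case by simp
qed simp

lemma open_bowen_ball:
  assumes "0 < n"
  shows "open (bowen_ball T n x e)"
proof -
  have "bowen_ball T n x e = (\<Inter>k\<in>{..<n}. (T ^^ k) -` ball ((T ^^ k) x) e)"
    by (auto simp: bowen_ball_def bowen_dist_less_iff[OF assms])
  then show ?thesis using continuous_funpow by (auto intro!: open_INT open_vimage)
qed

text \<open>Lower semicontinuity of the mass in the centre: balls of slightly smaller radius already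
  have mass above \<open>t\<close>, and such a ball is contained in the full ball around any
  sufficiently close centre.\<close>

lemma open_measure_bowen_ball_greater:
  assumes "prob_space \<mu>" and sets: "sets \<mu> = sets borel" and n: "0 < n"
  shows "open {x. t < measure \<mu> (bowen_ball T n x e)}"
proof (subst open_subopen, intro ballI)
  interpret prob_space \<mu> by fact
  have meas [measurable]: "bowen_ball T n x d \<in> sets \<mu>" for x d
    using open_bowen_ball[OF n] by (simp add: sets)
  fix x assume x: "x \<in> {x. t < measure \<mu> (bowen_ball T n x e)}"
  define A where "A k = bowen_ball T n x (e - 1 / real (Suc k))" for k
  have "incseq A"
  proof (rule incseq_SucI)
    fix k
    have "1 / real (Suc (Suc k)) \<le> 1 / real (Suc k)" by (simp add: field_simps)
    then show "A k \<subseteq> A (Suc k)"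
      unfolding A_def bowen_ball_def by (intro Collect_mono impI) linarith
  qed
  moreover have "(\<Union>k. A k) = bowen_ball T n x e"
  proof
    show "(\<Union>k. A k) \<subseteq> bowen_ball T n x e"
    proof
      fix y assume "y \<in> (\<Union>k. A k)"
      then obtain k where "bowen_dist T n x y < e - 1 / real (Suc k)" by (auto simp: A_def bowen_ball_def)
      moreover have "0 < 1 / real (Suc k)" by simp
      ultimately have "bowen_dist T n x y < e" by linarith
      then show "y \<in> bowen_ball T n x e" by (simp add: bowen_ball_def)
    qed
    show "bowen_ball T n x e \<subseteq> (\<Union>k. A k)"
    proof
      fix y assume "y \<in> bowen_ball T n x e"
      then have "0 < e - bowen_dist T n x y" by (simp add: bowen_ball_def)
      then obtain k where "1 / real (Suc k) < e - bowen_dist T n x y" using nat_approx_posE by blast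
      then have "y \<in> A k" unfolding A_def bowen_ball_def by simp
      then show "y \<in> (\<Union>k. A k)" by blast
    qed
  qed
  ultimately have "(\<lambda>k. measure \<mu> (A k)) \<longlonglongrightarrow> measure \<mu> (bowen_ball T n x e)"
    using finite_Lim_measure_incseq[of A] meas by (simp add: A_def image_subset_iff)
  then have "eventually (\<lambda>k. t < measure \<mu> (A k)) sequentially"
    using x by (intro order_tendstoD(1)) auto
  then obtain k where k: "t < measure \<mu> (A k)" by (auto simp: eventually_sequentially)
  have "t < measure \<mu> (bowen_ball T n z e)" if "z \<in> bowen_ball T n x (1 / real (Suc k))" for z
  proof -
    have "A k \<subseteq> bowen_ball T n z e"
    proof
      fix y assume "y \<in> A k"
      then show "y \<in> bowen_ball T n z e"
        using that bowen_dist_triangle[OF n, of T z y x] bowen_dist_commute[of T n z x]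
        unfolding A_def bowen_ball_def by simp
    qed
    then have "measure \<mu> (A k) \<le> measure \<mu> (bowen_ball T n z e)" by (intro finite_measure_mono) auto
    with k show ?thesis by simp
  qed
  moreover have "x \<in> bowen_ball T n x (1 / real (Suc k))"
    using n by (simp add: bowen_ball_def bowen_dist_refl)
  ultimately show "\<exists>S. open S \<and> x \<in> S \<and> S \<subseteq> {x. t < measure \<mu> (bowen_ball T n x e)}"
    using open_bowen_ball[OF n] by (intro exI[of _ "bowen_ball T n x (1 / real (Suc k))"]) blast
qed

lemma measurable_measure_bowen_ball:
  assumes "prob_space \<mu>" "sets \<mu> = sets borel"
  shows "(\<lambda>x. measure \<mu> (bowen_ball T n x e)) \<in> borel_measurable \<mu>"
proof (cases "n = 0")
  case True
  \<comment> \<open>At \<open>n = 0\<close> the Bowen distance is the same unspecified number for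
    all pairs, so the function is constant.\<close>
  then show ?thesis by (simp add: bowen_ball_def bowen_dist_def)
next
  case False
  have "space \<mu> = UNIV" using sets_eq_imp_space_eq[OF assms(2)] by simp
  then show ?thesis
    unfolding borel_measurable_iff_greater
    using open_measure_bowen_ball_greater[OF assms, of n] False assms(2) by simp
qed

section \<open>Local entropy is almost everywhere constant\<close>

definition bk_rate :: "'a measure \<Rightarrow> real \<Rightarrow> nat \<Rightarrow> 'a \<Rightarrow> ereal" where
  "bk_rate \<mu> e n x = (if measure \<mu> (bowen_ball T n x e) = 0 then \<infinity>
     else ereal (- (1 / real n) * ln (measure \<mu> (bowen_ball T n x e))))"

lemma bk_local_entropy_eq: "bk_local_entropy T \<mu> x e = limsup (\<lambda>n. bk_rate \<mu> e n x)"
  by (simp add: bk_local_entropy_def bk_rate_def)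

lemma bk_rate_le_iff:
  assumes "0 < n"
  shows "bk_rate \<mu> e n x \<le> ereal h \<longleftrightarrow> exp (- h * real n) \<le> measure \<mu> (bowen_ball T n x e)"
proof (cases "measure \<mu> (bowen_ball T n x e) = 0")
  case False
  then have pos: "0 < measure \<mu> (bowen_ball T n x e)" by (simp add: zero_less_measure_iff)
  have "- (1 / real n) * ln (measure \<mu> (bowen_ball T n x e)) \<le> h
      \<longleftrightarrow> - h * real n \<le> ln (measure \<mu> (bowen_ball T n x e))"
    using assms by (simp add: field_simps) linarith
  also have "\<dots> \<longleftrightarrow> exp (- h * real n) \<le> measure \<mu> (bowen_ball T n x e)"
    using pos by (simp add: ln_ge_iff)
  finally show ?thesis using False by (simp add: bk_rate_def)
qed (simp add: bk_rate_def not_le)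

lemma bk_local_entropy_nonneg:
  assumes "prob_space \<mu>"
  shows "0 \<le> bk_local_entropy T \<mu> x e"
proof -
  interpret prob_space \<mu> by fact
  have "0 \<le> bk_rate \<mu> e n x" for n
  proof (cases "measure \<mu> (bowen_ball T n x e) = 0")
    case False
    then have "0 < measure \<mu> (bowen_ball T n x e)" by (simp add: zero_less_measure_iff)
    then have "ln (measure \<mu> (bowen_ball T n x e)) \<le> 0" using prob_le_1 by (simp add: ln_le_zero_iff)
    then show ?thesis by (simp add: bk_rate_def divide_nonpos_nonneg)
  qed (simp add: bk_rate_def)
  then show ?thesis
    unfolding bk_local_entropy_eq by (intro le_Limsup) auto
qed

lemma measurable_bk_local_entropy:
  assumes "prob_space \<mu>" "sets \<mu> = sets borel"
  shows "(\<lambda>x. bk_local_entropy T \<mu> x e) \<in> borel_measurable \<mu>"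
proof -
  note [measurable] = measurable_measure_bowen_ball[OF assms]
  show ?thesis unfolding bk_local_entropy_def by measurable
qed

text \<open>\<open>T\<close> maps the ball of length \<open>n + 1\<close> around \<open>x\<close>
  into the ball of length \<open>n\<close> around \<open>T x\<close>, so invariance compares their
  masses. The change of length contributes the factor \<open>(n + 1) / n\<close>, which tends to
  1.\<close>

lemma bk_local_entropy_T_le:
  assumes \<mu>: "invariant_borel_prob T \<mu>"
  shows "bk_local_entropy T \<mu> (T x) e \<le> bk_local_entropy T \<mu> x e"
proof -
  interpret prob_space \<mu> using \<mu> by (simp add: invariant_borel_prob_def)
  have sets: "sets \<mu> = sets borel" using \<mu> by (simp add: invariant_borel_prob_def)
  define u where "u n = ereal (real (Suc n) / real n)" for n
  define v where "v n = bk_rate \<mu> e (n + 1) x" for n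
  have le: "bk_rate \<mu> e n (T x) \<le> u n * v n" if n: "0 < n" for n
  proof (cases "measure \<mu> (bowen_ball T (Suc n) x e) = 0")
    case True
    then show ?thesis using n by (simp add: u_def v_def bk_rate_def)
  next
    case False
    then have pos: "0 < measure \<mu> (bowen_ball T (Suc n) x e)" by (simp add: zero_less_measure_iff)
    have "bowen_ball T (Suc n) x e \<subseteq> T -` bowen_ball T n (T x) e"
    proof
      fix y assume "y \<in> bowen_ball T (Suc n) x e"
      then have "dist ((T ^^ Suc k) x) ((T ^^ Suc k) y) < e" if "k < n" for k
        using that unfolding bowen_ball_def mem_Collect_eq bowen_dist_less_iff[OF zero_less_Suc] by blast
      then show "y \<in> T -` bowen_ball T n (T x) e"
        using n by (simp add: bowen_ball_def bowen_dist_less_iff funpow_swap1)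
    qed
    then have "measure \<mu> (bowen_ball T (Suc n) x e) \<le> measure \<mu> (T -` bowen_ball T n (T x) e)"
      using open_bowen_ball[OF n] vimage_borel[OF continuous_T] by (intro finite_measure_mono) (auto simp: sets)
    also have "\<dots> = measure \<mu> (bowen_ball T n (T x) e)"
      using measure_in_invariant_charges[OF \<mu>] open_bowen_ball[OF n] by (simp add: invariant_charges_def)
    finally have m: "measure \<mu> (bowen_ball T (Suc n) x e) \<le> measure \<mu> (bowen_ball T n (T x) e)" .
    then have "ln (measure \<mu> (bowen_ball T (Suc n) x e)) \<le> ln (measure \<mu> (bowen_ball T n (T x) e))"
      using pos by simp
    then have "- (1 / real n) * ln (measure \<mu> (bowen_ball T n (T x) e))
        \<le> - (1 / real n) * ln (measure \<mu> (bowen_ball T (Suc n) x e))"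
      by (intro mult_left_mono_neg) auto
    also have "\<dots> = real (Suc n) / real n * (- (1 / real (Suc n)) * ln (measure \<mu> (bowen_ball T (Suc n) x e)))"
      using n by (simp add: divide_simps)
    finally show ?thesis
      using m pos by (simp add: u_def v_def bk_rate_def)
  qed
  have "bk_local_entropy T \<mu> (T x) e \<le> limsup (\<lambda>n. u n * v n)"
    unfolding bk_local_entropy_eq
    by (intro Limsup_mono eventually_mono[OF eventually_gt_at_top[of 0]]) (rule le)
  also have "\<dots> = 1 * limsup v"
  proof (rule ereal_limsup_lim_mult)
    have "(\<lambda>n. real (Suc n) / real n) \<longlonglongrightarrow> 1" by (rule LIMSEQ_Suc_n_over_n)
    then show "u \<longlonglongrightarrow> 1" unfolding u_def one_ereal_def by (simp only: tendsto_ereal)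
  qed auto
  also have "limsup v = bk_local_entropy T \<mu> x e"
    unfolding v_def bk_local_entropy_eq by (rule limsup_shift)
  finally show ?thesis by simp
qed

text \<open>The preimages of \<open>A\<close> increase and all have the mass of \<open>A\<close>, so
  their union is exactly invariant and has that mass too. Sublevel sets of the local entropy are of
  this kind.\<close>

lemma ergodic_forward_invariant:
  assumes \<mu>: "\<mu> \<in> ergodic_measures T" and A: "A \<in> sets borel" "A \<subseteq> T -` A"
  shows "measure \<mu> A = 0 \<or> measure \<mu> A = 1"
proof -
  have inv: "invariant_borel_prob T \<mu>" using \<mu> by (simp add: ergodic_measures_def)
  interpret prob_space \<mu> using inv by (simp add: invariant_borel_prob_def)
  have sets: "sets \<mu> = sets borel" using inv by (simp add: invariant_borel_prob_def)
  define B where "B n = (T ^^ n) -` A" for n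
  have B: "B n \<in> sets borel" for n
    unfolding B_def by (rule vimage_borel[OF continuous_funpow A(1)])
  have B_Suc: "B (Suc n) = T -` B n" for n by (auto simp: B_def funpow_swap1)
  have "B n \<subseteq> B (Suc n)" for n using A(2) by (auto simp: B_def)
  then have incB: "incseq B" by (rule incseq_SucI)
  have mB: "measure \<mu> (B n) = measure \<mu> A" for n
  proof (induction n)
    case (Suc n)
    then show ?case
      using measure_in_invariant_charges[OF inv] B by (simp add: B_Suc invariant_charges_def)
  qed (simp add: B_def)
  have "(\<lambda>n. measure \<mu> (B n)) \<longlonglongrightarrow> measure \<mu> (\<Union>n. B n)"
    using incB B by (intro finite_Lim_measure_incseq) (auto simp: sets)
  then have eq: "measure \<mu> (\<Union>n. B n) = measure \<mu> A" by (simp add: mB LIMSEQ_const_iff)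
  have "T -` (\<Union>n. B n) = (\<Union>n. B (Suc n))" by (auto simp: B_Suc)
  also have "\<dots> = (\<Union>n. B n)"
    using incB by (auto simp: incseq_Suc_iff)
  finally have "T -` (\<Union>n. B n) = (\<Union>n. B n)" .
  moreover have "(\<Union>n. B n) \<in> sets borel" using B by auto
  ultimately have "measure \<mu> (\<Union>n. B n) = 0 \<or> measure \<mu> (\<Union>n. B n) = 1"
    using \<mu> by (simp add: ergodic_measures_def)
  then show ?thesis by (simp add: eq)
qed

text \<open>Each sublevel set has mass 0 or 1, so almost every point is on the same side of every
  rational threshold simultaneously. Two values lying below the same rationals coincide, and the
  value at one such point \<open>x0\<close> is the constant.\<close>

lemma AE_bk_local_entropy:
  assumes \<mu>: "\<mu> \<in> ergodic_measures T"
  shows "AE x in \<mu>. bk_local_entropy T \<mu> x e = bk_entropy T \<mu> e"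
proof -
  have inv: "invariant_borel_prob T \<mu>" using \<mu> by (simp add: ergodic_measures_def)
  interpret prob_space \<mu> using inv by (simp add: invariant_borel_prob_def)
  have sets: "sets \<mu> = sets borel" using inv by (simp add: invariant_borel_prob_def)
  have sp: "space \<mu> = UNIV" using sets_eq_imp_space_eq[OF sets] by simp
  let ?f = "\<lambda>x. bk_local_entropy T \<mu> x e"
  have meas: "?f \<in> borel_measurable \<mu>"
    by (rule measurable_bk_local_entropy[OF prob_space_axioms sets])
  have dich: "AE x in \<mu>. ?f x < c \<longleftrightarrow> measure \<mu> {x. ?f x < c} = 1" for c
  proof -
    have S: "{x. ?f x < c} \<in> sets \<mu>"
      using measurable_sets[OF meas, of "{..<c}"] by (simp add: sp vimage_def)
    have "{x. ?f x < c} \<subseteq> T -` {x. ?f x < c}"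
    proof
      fix x assume "x \<in> {x. ?f x < c}"
      then show "x \<in> T -` {x. ?f x < c}"
        using bk_local_entropy_T_le[OF inv, of x e] by (auto intro: le_less_trans)
    qed
    then have "measure \<mu> {x. ?f x < c} = 0 \<or> measure \<mu> {x. ?f x < c} = 1"
      using ergodic_forward_invariant[OF \<mu>] S sets by auto
    then show ?thesis
    proof
      assume 0: "measure \<mu> {x. ?f x < c} = 0"
      have "AE x in \<mu>. \<not> ?f x < c"
        using 0 S by (intro AE_I[of _ _ "{x. ?f x < c}"]) (auto simp: emeasure_eq_measure)
      then show ?thesis by (simp add: 0)
    next
      assume 1: "measure \<mu> {x. ?f x < c} = 1"
      then have "AE x in \<mu>. x \<in> {x. ?f x < c}" by (rule AE_prob_1)
      then show ?thesis by (simp add: 1)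
    qed
  qed
  have all: "AE x in \<mu>. \<forall>q::rat. ?f x < ereal (real_of_rat q) \<longleftrightarrow> measure \<mu> {x. ?f x < ereal (real_of_rat q)} = 1"
    using dich by (simp add: AE_all_countable)
  have "\<exists>x. \<forall>q::rat. ?f x < ereal (real_of_rat q) \<longleftrightarrow> measure \<mu> {x. ?f x < ereal (real_of_rat q)} = 1"
  proof (rule ccontr)
    assume neg: "\<not> ?thesis"
    from all have "AE x in \<mu>. False" by eventually_elim (use neg in blast)
    then show False by simp
  qed
  then obtain x0 where x0: "\<forall>q::rat. ?f x0 < ereal (real_of_rat q) \<longleftrightarrow> measure \<mu> {x. ?f x < ereal (real_of_rat q)} = 1"
    by blast
  have const: "AE x in \<mu>. ?f x = ?f x0"
    using all
  proof eventually_elim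
    fix x assume x: "\<forall>q::rat. ?f x < ereal (real_of_rat q) \<longleftrightarrow> measure \<mu> {x. ?f x < ereal (real_of_rat q)} = 1"
    show "?f x = ?f x0"
    proof (rule ccontr)
      assume "?f x \<noteq> ?f x0"
      then consider "?f x < ?f x0" | "?f x0 < ?f x" by (rule linorder_neqE)
      then show False
      proof cases
        case 1
        then show False using ereal_dense3[OF 1] x x0 by (metis less_imp_not_less)
      next
        case 2
        then show False using ereal_dense3[OF 2] x x0 by (metis less_imp_not_less)
      qed
    qed
  qed
  have "(THE c. AE x in \<mu>. ?f x = c) = ?f x0"
  proof (rule the_equality[where P = "\<lambda>c. AE x in \<mu>. ?f x = c"])
    fix c assume "AE x in \<mu>. ?f x = c"
    with const have "AE x in \<mu>. c = ?f x0" by eventually_elim simp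
    then show "c = ?f x0" by simp
  qed (rule const)
  with const show ?thesis by (simp add: bk_entropy_def)
qed

lemma bk_entropy_nonneg:
  assumes \<mu>: "\<mu> \<in> ergodic_measures T"
  shows "0 \<le> bk_entropy T \<mu> e"
proof -
  interpret prob_space \<mu> using \<mu> by (simp add: ergodic_measures_def invariant_borel_prob_def)
  have "AE x in \<mu>. 0 \<le> bk_entropy T \<mu> e"
    using AE_bk_local_entropy[OF \<mu>, of e]
    by eventually_elim (metis bk_local_entropy_nonneg[OF prob_space_axioms])
  then show ?thesis by simp
qed

text \<open>Points whose balls have mass below \<open>exp (- s * real n)\<close> are covered by at
  most \<open>sep_number\<close> such balls. With \<open>s'\<close> strictly between the separation
  entropy and \<open>s\<close>, their total mass decays geometrically.\<close>

lemma bk_local_entropy_AE_le: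
  assumes \<mu>: "invariant_borel_prob T \<mu>" and e: "0 < e" and s: "sep_entropy T UNIV (e / 3) < ereal s"
  shows "AE x in \<mu>. bk_local_entropy T \<mu> x e \<le> ereal s"
proof -
  interpret prob_space \<mu> using \<mu> by (simp add: invariant_borel_prob_def)
  have sets: "sets \<mu> = sets borel" using \<mu> by (simp add: invariant_borel_prob_def)
  have sp: "space \<mu> = UNIV" using sets_eq_imp_space_eq[OF sets] by simp
  have ball [measurable]: "0 < n \<Longrightarrow> bowen_ball T n x d \<in> sets \<mu>" for n x d
    using open_bowen_ball by (simp add: sets)
  obtain s' where s': "sep_entropy T UNIV (e / 3) < ereal s'" "s' < s"
    using ereal_dense2[OF s] by auto
  obtain K where K: "1 \<le> K" "bowen_cover T (e / 3) 1 UNIV K"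
    using exists_bowen_cover_1[OF compact_UNIV, of "e / 3"] e by auto
  note cov = bowen_cover_power[OF K(2)]
  have "\<forall>\<^sub>F n in sequentially. ereal (1 / real n * ln (real (sep_number T n UNIV (e / 3)))) < ereal s'"
    using s'(1) unfolding sep_entropy_def by (rule Limsup_lessD)
  then obtain N0 where N0: "\<And>n. N0 \<le> n \<Longrightarrow> 1 / real n * ln (real (sep_number T n UNIV (e / 3))) < s'"
    by (auto simp: eventually_sequentially)
  define N where "N = max 1 N0"
  define bad where "bad n = (if N \<le> n then {x. measure \<mu> (bowen_ball T n x e) < exp (- s * real n)} else {})" for n
  have bad_sets: "bad n \<in> sets \<mu>" for n
    using measurable_sets[OF measurable_measure_bowen_ball[OF prob_space_axioms sets, of n e], of "{..< exp (- s * real n)}"]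
    by (auto simp: bad_def vimage_def sp)
  have bad_le: "measure \<mu> (bad n) \<le> exp (- (s - s')) ^ n" for n
  proof (cases "N \<le> n")
    case True
    then have n: "0 < n" "N0 \<le> n" by (auto simp: N_def)
    have sep1: "1 \<le> sep_number T n UNIV (e / 3)" using sep_number_le(2)[OF cov n(1)] .
    have "real (sep_number T n UNIV (e / 3)) = exp (ln (real (sep_number T n UNIV (e / 3))))"
      using sep1 by simp
    also have "\<dots> \<le> exp (s' * real n)"
      using N0[OF n(2)] n(1) by (simp add: field_simps del: exp_ln)
    finally have sep_le: "real (sep_number T n UNIV (e / 3)) \<le> exp (s' * real n)" .
    obtain E where E: "finite E" "separated T n (e / 3) E"
        and cover: "\<And>x. x \<in> UNIV \<Longrightarrow> \<exists>y\<in>E. bowen_dist T n y x \<le> e / 3"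
      by (rule exists_maximal_separated[of UNIV T n "e / 3" "sep_number T n UNIV (e / 3)"])
         (use sep_number_le(3)[OF cov n(1)] n(1) e in auto)
    \<comment> \<open>Small mass is known only for balls centred at bad points, so each useful point
      of \<open>E\<close> is replaced by a bad point \<open>w y\<close> nearby; the detour costs
      another \<open>e / 3\<close>.\<close>
    define E' where "E' = {y \<in> E. \<exists>x\<in>bad n. bowen_dist T n y x \<le> e / 3}"
    have "\<forall>y\<in>E'. \<exists>x. x \<in> bad n \<and> bowen_dist T n y x \<le> e / 3" by (auto simp: E'_def)
    then obtain w where w: "\<And>y. y \<in> E' \<Longrightarrow> w y \<in> bad n" "\<And>y. y \<in> E' \<Longrightarrow> bowen_dist T n y (w y) \<le> e / 3"
      by metis
    have fin: "finite E'" "card E' \<le> card E" using E(1) by (auto simp: E'_def intro: card_mono)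
    have sub: "bad n \<subseteq> (\<Union>y\<in>E'. bowen_ball T n (w y) e)"
    proof
      fix x assume x: "x \<in> bad n"
      obtain y where y: "y \<in> E" "bowen_dist T n y x \<le> e / 3" using cover by auto
      then have "y \<in> E'" using x by (auto simp: E'_def)
      moreover have "bowen_dist T n (w y) x < e"
        using bowen_dist_triangle[OF n(1), of T "w y" x y] w(2)[OF \<open>y \<in> E'\<close>] y(2) e
          bowen_dist_commute[of T n y "w y"] by simp
      ultimately show "x \<in> (\<Union>y\<in>E'. bowen_ball T n (w y) e)" by (auto simp: bowen_ball_def)
    qed
    have "measure \<mu> (bad n) \<le> measure \<mu> (\<Union>y\<in>E'. bowen_ball T n (w y) e)"
      using sub fin(1) n(1) by (intro finite_measure_mono) auto
    also have "\<dots> \<le> (\<Sum>y\<in>E'. measure \<mu> (bowen_ball T n (w y) e))"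
      using fin(1) n(1) by (intro finite_measure_subadditive_finite) auto
    also have "\<dots> \<le> (\<Sum>y\<in>E'. exp (- s * real n))"
      using w(1) True by (intro sum_mono) (auto simp: bad_def intro: less_imp_le)
    also have "\<dots> = real (card E') * exp (- s * real n)" by simp
    also have "\<dots> \<le> exp (s' * real n) * exp (- s * real n)"
    proof (intro mult_right_mono)
      have "card E' \<le> sep_number T n UNIV (e / 3)"
        using fin(2) sep_number_le(3)[OF cov n(1) E] by simp
      then show "real (card E') \<le> exp (s' * real n)" using sep_le by linarith
    qed simp
    also have "\<dots> = exp (- (s - s')) ^ n"
      by (simp add: exp_of_nat_mult[symmetric] exp_add[symmetric] algebra_simps)
    finally show ?thesis .
  qed (simp add: bad_def)
  have "summable (\<lambda>n. exp (- (s - s')) ^ n)" using s'(2) by (intro summable_geometric) simp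
  then have "summable (\<lambda>n. measure \<mu> (bad n))"
    by (rule summable_comparison_test'[where N = 0])
      (simp only: real_norm_def abs_of_nonneg measure_nonneg bad_le)
  then have "AE x in \<mu>. eventually (\<lambda>n. x \<in> space \<mu> - bad n) sequentially"
    using bad_sets by (intro borel_cantelli_AE1) (auto simp: emeasure_eq_measure)
  then show ?thesis
  proof eventually_elim
    fix x assume "\<forall>\<^sub>F n in sequentially. x \<in> space \<mu> - bad n"
    then have "\<forall>\<^sub>F n in sequentially. bk_rate \<mu> e n x \<le> ereal s"
      using eventually_ge_at_top[of N]
    proof eventually_elim
      fix n assume "x \<in> space \<mu> - bad n" "N \<le> n"
      then show "bk_rate \<mu> e n x \<le> ereal s" by (subst bk_rate_le_iff) (auto simp: bad_def N_def)
    qed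
    then show "bk_local_entropy T \<mu> x e \<le> ereal s"
      unfolding bk_local_entropy_eq by (rule Limsup_bounded)
  qed
qed

lemma bk_entropy_le_sep_entropy:
  assumes \<mu>: "\<mu> \<in> ergodic_measures T" and e: "0 < e"
  shows "bk_entropy T \<mu> e \<le> sep_entropy T UNIV (e / 3)"
proof (rule dense_ge)
  have inv: "invariant_borel_prob T \<mu>" using \<mu> by (simp add: ergodic_measures_def)
  interpret prob_space \<mu> using inv by (simp add: invariant_borel_prob_def)
  fix s assume s: "sep_entropy T UNIV (e / 3) < s"
  show "bk_entropy T \<mu> e \<le> s"
  proof (cases s)
    case (real s')
    have "AE x in \<mu>. bk_local_entropy T \<mu> x e \<le> ereal s'"
      using bk_local_entropy_AE_le[OF inv e] s real by simp
    with AE_bk_local_entropy[OF \<mu>, of e] have "AE x in \<mu>. bk_entropy T \<mu> e \<le> ereal s'"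
      by eventually_elim simp
    then show ?thesis using real by simp
  qed (use s in auto)
qed

text \<open>Points whose balls have mass at least \<open>exp (- h * real n)\<close> admit at most
  \<open>exp (h * real n)\<close> disjoint balls. Centres are taken from \<open>D\<close> so that,
  for countable \<open>D\<close>, only countably many families occur over all ergodic
  measures.\<close>

lemma exists_bowen_balls_of_bk_entropy_less:
  assumes \<mu>: "\<mu> \<in> ergodic_measures T" and e: "0 < e" and h: "bk_entropy T \<mu> e < ereal h" and \<eta>: "0 < \<eta>"
    and dense: "\<And>x d. 0 < d \<Longrightarrow> \<exists>y\<in>D. dist x y < d"
  obtains n F where "N \<le> n" "finite F" "F \<subseteq> D" "real (card F) \<le> exp (h * real n)"
    "measure \<mu> (- (\<Union>y\<in>F. bowen_ball T n y (4 * e))) < \<eta>"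
proof -
  have inv: "invariant_borel_prob T \<mu>" using \<mu> by (simp add: ergodic_measures_def)
  interpret prob_space \<mu> using inv by (simp add: invariant_borel_prob_def)
  have sets: "sets \<mu> = sets borel" using inv by (simp add: invariant_borel_prob_def)
  have sp: "space \<mu> = UNIV" using sets_eq_imp_space_eq[OF sets] by simp
  define A where "A n = {x. exp (- h * real n) \<le> measure \<mu> (bowen_ball T n x e)}" for n
  have A: "A n \<in> sets \<mu>" for n
    using measurable_sets[OF measurable_measure_bowen_ball[OF prob_space_axioms sets, of n e], of "{exp (- h * real n)..}"]
    by (simp add: A_def vimage_def sp)
  have ev: "AE x in \<mu>. \<exists>m. \<forall>n\<ge>m. x \<in> A n"
    using AE_bk_local_entropy[OF \<mu>, of e]
  proof eventually_elim
    fix x assume "bk_local_entropy T \<mu> x e = bk_entropy T \<mu> e"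
    then have "limsup (\<lambda>n. bk_rate \<mu> e n x) < ereal h" using h by (simp add: bk_local_entropy_eq)
    then have "\<forall>\<^sub>F n in sequentially. bk_rate \<mu> e n x < ereal h" by (rule Limsup_lessD)
    then have "\<forall>\<^sub>F n in sequentially. x \<in> A n"
      using eventually_gt_at_top[of 0]
    proof eventually_elim
      fix n :: nat assume "bk_rate \<mu> e n x < ereal h" "0 < n"
      then show "x \<in> A n" unfolding A_def mem_Collect_eq by (subst bk_rate_le_iff[symmetric]) simp_all
    qed
    then show "\<exists>m. \<forall>n\<ge>m. x \<in> A n" by (simp add: eventually_sequentially)
  qed
  \<comment> \<open>An Egorov-type step: the threshold depends on the point, but one
    \<open>m\<close> serves all points outside a set of mass less than \<eta>.\<close>
  define B where "B m = (\<Inter>n\<in>{m..}. A n)" for m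
  have B: "B m \<in> sets \<mu>" for m unfolding B_def using A by (intro sets.countable_INT) auto
  have "incseq B" unfolding B_def by (intro incseq_SucI) auto
  then have "(\<lambda>m. measure \<mu> (B m)) \<longlonglongrightarrow> measure \<mu> (\<Union>m. B m)"
    using B by (intro finite_Lim_measure_incseq) auto
  moreover have "AE x in \<mu>. x \<in> (\<Union>m. B m)"
    using ev by eventually_elim (auto simp: B_def)
  then have "measure \<mu> (\<Union>m. B m) = 1" using B by (subst (asm) AE_in_set_eq_1) auto
  ultimately have "eventually (\<lambda>m. 1 - \<eta> < measure \<mu> (B m)) sequentially"
    using \<eta> by (intro order_tendstoD(1)[of _ 1]) auto
  then obtain m where m: "1 - \<eta> < measure \<mu> (B m)" by (auto simp: eventually_sequentially)
  define n where "n = Suc (max m N)"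
  have n: "0 < n" "N \<le> n" "m \<le> n" by (auto simp: n_def)
  have An: "1 - \<eta> < measure \<mu> (A n)"
    using m A[of n] n(3) finite_measure_mono[of "B m" "A n"] by (force simp: B_def)
  have ball: "bowen_ball T n x d \<in> sets \<mu>" for x d using open_bowen_ball[OF n(1)] by (simp add: sets)
  have card_le: "real (card E) \<le> exp (h * real n)" if E: "finite E" "E \<subseteq> A n" "separated T n (2 * e) E" for E
  proof -
    have disj: "disjoint_family_on (\<lambda>y. bowen_ball T n y e) E"
      unfolding disjoint_family_on_def
    proof (intro ballI impI)
      fix x y assume xy: "x \<in> E" "y \<in> E" "x \<noteq> y"
      then have far: "2 * e < bowen_dist T n x y" using E(3) unfolding separated_def by blast
      show "bowen_ball T n x e \<inter> bowen_ball T n y e = {}"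
      proof (rule ccontr)
        assume "bowen_ball T n x e \<inter> bowen_ball T n y e \<noteq> {}"
        then obtain z where "bowen_dist T n x z < e" "bowen_dist T n y z < e" by (auto simp: bowen_ball_def)
        then show False
          using far bowen_dist_triangle[OF n(1), of T x y z] bowen_dist_commute[of T n y z] by simp
      qed
    qed
    have "real (card E) * exp (- h * real n) = (\<Sum>y\<in>E. exp (- h * real n))" by simp
    also have "\<dots> \<le> (\<Sum>y\<in>E. measure \<mu> (bowen_ball T n y e))"
      using E(2) by (intro sum_mono) (auto simp: A_def)
    also have "\<dots> = measure \<mu> (\<Union>y\<in>E. bowen_ball T n y e)"
      using disj E(1) ball by (intro finite_measure_finite_Union[symmetric]) auto
    also have "\<dots> \<le> 1" by (rule prob_le_1)
    finally show ?thesis by (simp add: exp_minus field_simps)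
  qed
  obtain E where E: "finite E" "E \<subseteq> A n" "separated T n (2 * e) E"
      and cover: "\<And>x. x \<in> A n \<Longrightarrow> \<exists>y\<in>E. bowen_dist T n y x \<le> 2 * e"
    by (rule exists_maximal_separated[of "A n" T n "2 * e" "nat \<lfloor>exp (h * real n)\<rfloor>"])
       (use card_le n(1) e in \<open>auto simp: le_nat_floor\<close>)
  \<comment> \<open>\<open>D\<close> is dense for \<open>dist\<close>; openness of Bowen balls makes
    it dense for each Bowen metric.\<close>
  have "\<exists>z\<in>D. bowen_dist T n y z < e" for y
  proof -
    have "y \<in> bowen_ball T n y e" using n(1) e by (simp add: bowen_ball_def bowen_dist_refl)
    then obtain d where "0 < d" "ball y d \<subseteq> bowen_ball T n y e"
      using open_bowen_ball[OF n(1)] openE by blast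
    then show ?thesis using dense[of d y] by (auto simp: bowen_ball_def subset_iff)
  qed
  then obtain f where f: "\<And>y. f y \<in> D" "\<And>y. bowen_dist T n y (f y) < e" by metis
  have "A n \<subseteq> (\<Union>y\<in>f ` E. bowen_ball T n y (4 * e))"
  proof
    fix x assume "x \<in> A n"
    then obtain y where y: "y \<in> E" "bowen_dist T n y x \<le> 2 * e" using cover by blast
    have "bowen_dist T n (f y) x < 4 * e"
      using bowen_dist_triangle[OF n(1), of T "f y" x y] bowen_dist_commute[of T n y "f y"] f(2)[of y] y(2) e by simp
    then show "x \<in> (\<Union>y\<in>f ` E. bowen_ball T n y (4 * e))" using y(1) by (auto simp: bowen_ball_def)
  qed
  then have "measure \<mu> (- (\<Union>y\<in>f ` E. bowen_ball T n y (4 * e))) \<le> measure \<mu> (UNIV - A n)"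
    using A[of n] sp sets.compl_sets[OF A[of n]] by (intro finite_measure_mono) auto
  also have "\<dots> = 1 - measure \<mu> (A n)" using prob_compl[OF A[of n]] by (simp add: sp)
  also have "\<dots> < \<eta>" using An by simp
  finally have "measure \<mu> (- (\<Union>y\<in>f ` E. bowen_ball T n y (4 * e))) < \<eta>" .
  moreover have "real (card (f ` E)) \<le> exp (h * real n)"
    using card_le[OF E] card_image_le[OF E(1), of f] by linarith
  ultimately show ?thesis using that[of n "f ` E"] n E(1) f(1) by auto
qed

text \<open>By invariance the expected number of visits is
  \<open>real n * measure \<mu> B\<close>.\<close>

lemma visits_Markov:
  assumes \<mu>: "invariant_borel_prob T \<mu>" and B: "B \<in> sets borel" and "0 < n" "0 < \<eta>"
  shows "measure \<mu> {y. \<eta> * real n < real (visits T B n y)} \<le> measure \<mu> B / \<eta>"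
proof -
  interpret prob_space \<mu> using \<mu> by (simp add: invariant_borel_prob_def)
  have sets: "sets \<mu> = sets borel" using \<mu> by (simp add: invariant_borel_prob_def)
  have sp: "space \<mu> = UNIV" using sets_eq_imp_space_eq[OF sets] by simp
  have Bt: "(T ^^ t) -` B \<in> sets \<mu>" for t using vimage_borel[OF continuous_funpow B] by (simp add: sets)
  have mB: "measure \<mu> ((T ^^ t) -` B) = measure \<mu> B" for t
  proof (induction t)
    case (Suc t)
    have "(T ^^ Suc t) -` B = T -` ((T ^^ t) -` B)" by (auto simp: funpow_swap1)
    then have "measure \<mu> ((T ^^ Suc t) -` B) = measure \<mu> (T -` ((T ^^ t) -` B))" by (simp only:)
    also have "\<dots> = measure \<mu> ((T ^^ t) -` B)"
      using measure_in_invariant_charges[OF \<mu>] Bt[of t] by (simp add: invariant_charges_def sets)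
    finally show ?case unfolding Suc .
  qed simp
  have eq: "real (visits T B n y) = (\<Sum>t<n. indicator ((T ^^ t) -` B) y)" for y
    unfolding visits_eq_sum by (simp add: indicator_def)
  have int: "integrable \<mu> (\<lambda>y. real (visits T B n y))"
    unfolding eq using Bt by (intro Bochner_Integration.integrable_sum integrable_real_indicator) (auto simp: emeasure_eq_measure)
  have I: "(\<integral>y. real (visits T B n y) \<partial>\<mu>) = real n * measure \<mu> B"
    unfolding eq using Bt mB
    by (subst Bochner_Integration.integral_sum) (auto simp: emeasure_eq_measure sp intro!: integrable_real_indicator)
  have "measure \<mu> {y. \<eta> * real n < real (visits T B n y)} \<le> measure \<mu> {y \<in> space \<mu>. \<eta> * real n \<le> real (visits T B n y)}"
    using measurable_sets[OF borel_measurable_integrable[OF int], of "{\<eta> * real n..}"]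
    by (intro finite_measure_mono) (auto simp: sp vimage_def)
  also have "\<dots> \<le> (\<integral>y. real (visits T B n y) \<partial>\<mu>) / (\<eta> * real n)"
    using assms(3,4) by (intro integral_Markov_inequality_measure[OF int, of "{}"]) auto
  also have "\<dots> = measure \<mu> B / \<eta>" using assms(3,4) by (simp add: I field_simps)
  finally show ?thesis .
qed

text \<open>Nearby points are still in the open set \<open>V\<close> at every time when
  \<open>y\<close> is, so visits to the complement cannot increase.\<close>

lemma open_visits_le:
  assumes "open V"
  shows "open {y. real (visits T (- V) n y) \<le> c}"
proof (subst open_subopen, intro ballI)
  fix y assume y: "y \<in> {y. real (visits T (- V) n y) \<le> c}"
  define S where "S = {t. t < n \<and> (T ^^ t) y \<in> V}"
  have "finite S" by (simp add: S_def)
  then have "open (\<Inter>t\<in>S. (T ^^ t) -` V)"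
    using continuous_funpow assms by (intro open_INT) (auto intro: open_vimage)
  moreover have "visits T (- V) n z \<le> visits T (- V) n y" if "z \<in> (\<Inter>t\<in>S. (T ^^ t) -` V)" for z
    unfolding visits_def using that by (intro card_mono) (auto simp: S_def)
  then have "(\<Inter>t\<in>S. (T ^^ t) -` V) \<subseteq> {y. real (visits T (- V) n y) \<le> c}"
    using y by fastforce
  moreover have "y \<in> (\<Inter>t\<in>S. (T ^^ t) -` V)" by (auto simp: S_def)
  ultimately show "\<exists>U. open U \<and> y \<in> U \<and> U \<subseteq> {y. real (visits T (- V) n y) \<le> c}" by blast
qed

end

section \<open>The variational inequality\<close>

text \<open>At most \<open>\<eta> * real M\<close> exceptional steps cost at most
  \<open>exp (\<delta> * real M)\<close> by the condition on \<eta>; together with the loss \<delta>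
  of the tiling itself this gives the rate \<open>a + 2 * \<delta>\<close>.\<close>

lemma bowen_cover_tiling_density:
  fixes T :: "'a::metric_space \<Rightarrow> 'a"
  assumes K: "1 \<le> K" "bowen_cover T r 1 UNIV K" and a: "0 \<le> a" "0 \<le> \<delta>"
    and \<eta>: "0 \<le> \<eta>" "\<eta> * ln (2 * K) \<le> \<delta>"
    and I: "finite I" "0 \<notin> I" "(\<Sum>n\<in>I. exp (- \<delta> * real n)) \<le> 1 / 2"
    and G: "\<And>n. n \<in> I \<Longrightarrow> bowen_cover T r n (G n) (exp (a * real n))"
  shows "\<exists>C\<ge>1. \<forall>M. bowen_cover T r M {y. real (visits T (- (\<Union>n\<in>I. G n)) M y) \<le> \<eta> * real M}
    (C * exp ((a + 2 * \<delta>) * real M))"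
proof -
  obtain C where C: "1 \<le> C"
    "\<And>M q. bowen_cover T r M {y. visits T (- (\<Union>n\<in>I. G n)) M y \<le> q} (C * exp ((a + \<delta>) * real M) * (2 * K) ^ q)"
    using bowen_cover_tiling[OF K a I G] by blast
  have "bowen_cover T r M {y. real (visits T (- (\<Union>n\<in>I. G n)) M y) \<le> \<eta> * real M}
    (C * exp ((a + 2 * \<delta>) * real M))" for M
  proof (rule bowen_cover_mono[OF C(2)[of M "nat \<lfloor>\<eta> * real M\<rfloor>"]])
    show "{y. real (visits T (- (\<Union>n\<in>I. G n)) M y) \<le> \<eta> * real M}
        \<subseteq> {y. visits T (- (\<Union>n\<in>I. G n)) M y \<le> nat \<lfloor>\<eta> * real M\<rfloor>}"
      by (auto simp: le_nat_floor)
    define q where "q = nat \<lfloor>\<eta> * real M\<rfloor>"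
    have "real q \<le> \<eta> * real M" using \<eta>(1) by (simp add: q_def)
    then have "real q * ln (2 * K) \<le> \<eta> * real M * ln (2 * K)" using K(1) by (intro mult_right_mono) auto
    also have "\<dots> = \<eta> * ln (2 * K) * real M" by (simp only: mult_ac)
    also have "\<dots> \<le> \<delta> * real M" using \<eta>(2) by (intro mult_right_mono) auto
    finally have "exp (real q * ln (2 * K)) \<le> exp (\<delta> * real M)" by simp
    moreover have "exp (real q * ln (2 * K)) = (2 * K) ^ q" using K(1) by (simp add: exp_of_nat_mult)
    ultimately have "(2 * K) ^ q \<le> exp (\<delta> * real M)" by (simp only:)
    then have "C * exp ((a + \<delta>) * real M) * (2 * K) ^ q \<le> C * exp ((a + \<delta>) * real M) * exp (\<delta> * real M)"
      using C(1) by (intro mult_left_mono) auto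
    also have "\<dots> = C * (exp ((a + \<delta>) * real M) * exp (\<delta> * real M))" by (simp only: mult_ac)
    also have "exp ((a + \<delta>) * real M) * exp (\<delta> * real M) = exp ((a + 2 * \<delta>) * real M)"
      by (simp only: exp_add[symmetric]) (simp add: algebra_simps)
    finally show "C * exp ((a + \<delta>) * real M) * (2 * K) ^ nat \<lfloor>\<eta> * real M\<rfloor> \<le> C * exp ((a + 2 * \<delta>) * real M)"
      by (simp only: q_def)
  qed
  with C(1) show ?thesis by blast
qed

lemma sep_entropy_le_of_bowen_cover:
  assumes "0 < C" "\<And>M. N < M \<Longrightarrow> bowen_cover T r M UNIV (C * exp (b * real M))"
  shows "sep_entropy T UNIV r \<le> ereal b"
proof -
  have "sep_entropy T UNIV r \<le> limsup (\<lambda>M. ereal (ln C / real M + b))"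
    unfolding sep_entropy_def
  proof (rule Limsup_mono, use eventually_gt_at_top[of N] in eventually_elim)
    fix M assume M: "N < M"
    have s: "real (sep_number T M UNIV r) \<le> C * exp (b * real M)" "1 \<le> sep_number T M UNIV r"
      using sep_number_le[OF assms(2)[OF M]] M by auto
    then have "ln (real (sep_number T M UNIV r)) \<le> ln (C * exp (b * real M))" by simp
    also have "\<dots> = ln C + b * real M" using \<open>0 < C\<close> by (simp add: ln_mult)
    finally show "ereal (1 / real M * ln (real (sep_number T M UNIV r))) \<le> ereal (ln C / real M + b)"
      using M by (simp add: field_simps)
  qed
  also have "\<dots> = ereal b"
  proof (rule lim_imp_Limsup)
    have "(\<lambda>M. ln C / real M + b) \<longlonglongrightarrow> 0 + b"
      by (intro tendsto_add tendsto_const lim_const_over_n)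
    then show "(\<lambda>M. ereal (ln C / real M + b)) \<longlonglongrightarrow> ereal b" by simp
  qed simp
  finally show ?thesis .
qed

context compact_system
begin

text \<open>Two levels of tiling are needed because the number of candidate families \<open>(n, F)\<close> is not
  controlled by \<open>n\<close>: within a window of length \<open>M\<close> only one of the first \<open>M\<close> families is used, so the
  choice of the family costs only a factor \<open>M\<close>. The windows are then tiled together, their
  complement being visited rarely since it is small for every ergodic measure.\<close>

lemma sep_entropy_le_add:
  assumes e: "0 < e" and h: "0 \<le> h" and \<delta>: "0 < \<delta>"
    and less: "\<And>\<mu>. \<mu> \<in> ergodic_measures T \<Longrightarrow> bk_entropy T \<mu> e < ereal h"
  shows "sep_entropy T UNIV (8 * e) \<le> ereal (h + 5 * \<delta>)"
proof -
  obtain K where K: "1 \<le> K" "bowen_cover T (8 * e) 1 UNIV K"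
    using exists_bowen_cover_1[OF compact_UNIV, of "8 * e"] e by auto
  obtain D :: "'a set" where D: "countable D" "\<And>x d. 0 < d \<Longrightarrow> \<exists>y\<in>D. dist x y < d"
    by (rule compact_countable_dense[OF compact_UNIV]) (use that in blast)
  have lnK: "0 < ln (2 * K)" using K(1) by simp
  define \<eta> where "\<eta> = \<delta> / ln (2 * K)"
  have \<eta>: "0 < \<eta>" "\<eta> * ln (2 * K) \<le> \<delta>" using lnK \<delta> by (simp_all add: \<eta>_def)
  have "summable (\<lambda>n. exp (- \<delta>) ^ n)" using \<delta> by (intro summable_geometric) simp
  then have "summable (\<lambda>n. exp (- \<delta> * real n))"
    by (simp only: exp_of_nat2_mult)
  \<comment> \<open>Used at both levels: for a single block length, and for the whole range of
    window lengths, however long that range becomes.\<close>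
  then obtain N2 where N2: "\<And>m n. N2 \<le> m \<Longrightarrow> norm (\<Sum>k=m..n. exp (- \<delta> * real k)) < 1 / 2"
    by (rule summable_partial_sum_bound[of _ "1 / 2"]) (use that in auto)
  have "(\<lambda>M. real M * real M * exp (- \<delta> * real M)) \<longlonglongrightarrow> 0"
    using \<delta> by real_asymp
  then have "\<forall>\<^sub>F M in sequentially. real M * real M * exp (- \<delta> * real M) < 1"
    by (rule order_tendstoD(2)) simp
  then obtain N3 where N3: "\<And>M. N3 \<le> M \<Longrightarrow> real M * real M * exp (- \<delta> * real M) < 1"
    by (auto simp: eventually_sequentially)
  define N1 where "N1 = max 1 (max N2 N3)"
  have "N2 \<le> N1" by (simp add: N1_def)
  \<comment> \<open>The condition \<open>exp (- \<delta> * real n) \<le> 1 / 2\<close> is the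
    exponential sum bound for the single block length \<open>n\<close>.\<close>
  define P where "P = {(n, F). 0 < n \<and> exp (- \<delta> * real n) \<le> 1 / 2 \<and> finite F \<and> F \<subseteq> D \<and> real (card F) \<le> exp (h * real n)}"
  have "countable (UNIV \<times> {F. finite F \<and> F \<subseteq> D} :: (nat \<times> 'a set) set)"
    using countable_Collect_finite_subset[OF D(1)] by simp
  then have "countable P" by (rule countable_subset[rotated]) (auto simp: P_def)
  define V where "V p = (\<Union>y\<in>snd p. bowen_ball T (fst p) y (4 * e))" for p
  have openV: "open (V p)" if "p \<in> P" for p
    using that open_bowen_ball by (auto simp: V_def P_def)
  define A where "A p M = {y. real (visits T (- V p) M y) \<le> \<eta> * real M}" for p M
  have "\<exists>C\<ge>1. \<forall>M. bowen_cover T (8 * e) M (A p M) (C * exp ((h + 2 * \<delta>) * real M))" if p: "p \<in> P" for p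
  proof -
    obtain n F where nF: "p = (n, F)" by (cases p)
    have "bowen_cover T (8 * e) n (V p) (exp (h * real n))"
      using bowen_cover_mono[OF bowen_cover_bowen_balls[of F n T "4 * e"], of "V p"] p by (auto simp: P_def V_def nF)
    then have "\<exists>C\<ge>1. \<forall>M. bowen_cover T (8 * e) M {y. real (visits T (- (\<Union>n\<in>{n}. V p)) M y) \<le> \<eta> * real M}
        (C * exp ((h + 2 * \<delta>) * real M))"
      using p \<eta> \<delta> h by (intro bowen_cover_tiling_density[OF K]) (auto simp: P_def nF)
    then show ?thesis by (simp add: A_def)
  qed
  then have "\<forall>p\<in>P. \<exists>C. 1 \<le> C \<and> (\<forall>M. bowen_cover T (8 * e) M (A p M) (C * exp ((h + 2 * \<delta>) * real M)))"
    by blast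
  then obtain C where C: "\<forall>p\<in>P. 1 \<le> C p \<and> (\<forall>M. bowen_cover T (8 * e) M (A p M) (C p * exp ((h + 2 * \<delta>) * real M)))"
    by (rule bchoice[THEN exE])
  define Q where "Q M = {p \<in> P. to_nat_on P p < M \<and> C p \<le> real M}" for M
  define G where "G M = (\<Union>p\<in>Q M. A p M)" for M
  have openG: "open (G M)" for M
    unfolding G_def A_def Q_def using openV by (intro open_UN ballI open_visits_le) auto
  have coverG: "bowen_cover T (8 * e) M (G M) (exp ((h + 3 * \<delta>) * real M))" if M: "N1 \<le> M" for M
  proof -
    have inj: "inj_on (to_nat_on P) (Q M)"
      using inj_on_to_nat_on[OF \<open>countable P\<close>] by (rule inj_on_subset) (auto simp: Q_def)
    moreover have img: "to_nat_on P ` Q M \<subseteq> {..<M}" by (auto simp: Q_def)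
    ultimately have Q: "finite (Q M)" "card (Q M) \<le> M"
      using inj_on_finite[OF inj img] card_inj_on_le[OF inj img] by auto
    let ?x = "exp ((h + 2 * \<delta>) * real M)"
    have "bowen_cover T (8 * e) M (G M) (\<Sum>p\<in>Q M. real M * ?x)"
      unfolding G_def
    proof (rule bowen_cover_UN[OF Q(1)])
      fix p assume "p \<in> Q M"
      then have "bowen_cover T (8 * e) M (A p M) (C p * ?x)" "C p * ?x \<le> real M * ?x"
        using C by (auto simp: Q_def)
      then show "bowen_cover T (8 * e) M (A p M) (real M * ?x)" by (rule bowen_cover_mono[OF _ subset_refl])
    qed
    moreover have "(\<Sum>p\<in>Q M. real M * ?x) \<le> exp ((h + 3 * \<delta>) * real M)"
    proof -
      have "(\<Sum>p\<in>Q M. real M * ?x) = real (card (Q M)) * (real M * ?x)" by simp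
      also have "\<dots> \<le> real M * (real M * ?x)" using Q(2) by (intro mult_right_mono) auto
      also have "\<dots> = (real M * real M * exp (- \<delta> * real M)) * (exp (\<delta> * real M) * ?x)"
        by (simp add: exp_minus field_simps)
      also have "\<dots> \<le> 1 * (exp (\<delta> * real M) * ?x)"
        using N3[of M] M by (intro mult_right_mono) (auto simp: N1_def)
      also have "\<dots> = exp ((h + 3 * \<delta>) * real M)"
        by (simp only: mult_1 exp_add[symmetric]) (simp add: algebra_simps)
      finally show ?thesis .
    qed
    ultimately show ?thesis by (rule bowen_cover_mono[OF _ subset_refl])
  qed
  \<comment> \<open>Points at which no tiled window with length in the given range begins.\<close>
  define R where "R j = - (\<Union>M\<in>{N1..N1 + j}. G M)" for j
  have clR: "closed (R j)" for j unfolding R_def using openG by (intro closed_Compl open_UN) auto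
  have decR: "decseq R" unfolding R_def by (intro decseq_SucI) auto
  have small: "measure \<mu> (\<Inter>j. R j) < \<eta>" if \<mu>: "\<mu> \<in> ergodic_measures T" for \<mu>
  proof -
    have inv: "invariant_borel_prob T \<mu>" using \<mu> by (simp add: ergodic_measures_def)
    interpret prob_space \<mu> using inv by (simp add: invariant_borel_prob_def)
    have sets: "sets \<mu> = sets borel" using inv by (simp add: invariant_borel_prob_def)
    \<comment> \<open>One factor of \<open>\<eta> * \<eta>\<close> is consumed by the Markov
      inequality, leaving mass less than \<eta>.\<close>
    obtain n F where F: "max 1 N2 \<le> n" "finite F" "F \<subseteq> D" "real (card F) \<le> exp (h * real n)"
        "measure \<mu> (- (\<Union>y\<in>F. bowen_ball T n y (4 * e))) < \<eta> * \<eta>"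
      using exists_bowen_balls_of_bk_entropy_less[OF \<mu> e less[OF \<mu>] _ D(2), of "\<eta> * \<eta>" "max 1 N2"] \<eta>(1) by auto
    have "exp (- \<delta> * real n) \<le> 1 / 2" using N2[of n n] F(1) by simp
    then have p: "(n, F) \<in> P" using F by (auto simp: P_def)
    define M where "M = max N1 (max (Suc (to_nat_on P (n, F))) (nat \<lceil>C (n, F)\<rceil>))"
    have M: "N1 \<le> M" "0 < M" "(n, F) \<in> Q M"
      using p by (auto simp: M_def Q_def) (simp add: real_nat_ceiling_ge le_max_iff_disj of_nat_max)
    have "(\<Inter>j. R j) \<subseteq> R (M - N1)" by blast
    also have "\<dots> \<subseteq> - G M" using M(1) by (auto simp: R_def)
    also have "\<dots> \<subseteq> - A (n, F) M" using M(3) by (auto simp: G_def)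
    also have "\<dots> = {y. \<eta> * real M < real (visits T (- V (n, F)) M y)}" by (auto simp: A_def)
    finally have sub: "(\<Inter>j. R j) \<subseteq> {y. \<eta> * real M < real (visits T (- V (n, F)) M y)}" .
    have "- A (n, F) M \<in> sets borel"
      unfolding A_def using open_visits_le[OF openV[OF p]] by (intro borel_comp) simp
    then have "measure \<mu> (\<Inter>j. R j) \<le> measure \<mu> {y. \<eta> * real M < real (visits T (- V (n, F)) M y)}"
      using sub by (intro finite_measure_mono) (auto simp: A_def sets Compl_eq not_le)
    also have "\<dots> \<le> measure \<mu> (- V (n, F)) / \<eta>"
      using openV[OF p] M \<eta> by (intro visits_Markov[OF inv]) auto
    also have "\<dots> < \<eta>" using F(5) \<eta>(1) by (simp add: V_def field_simps)
    finally show ?thesis .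
  qed
  \<comment> \<open>Here the bounds for individual ergodic measures become uniform: one finite range
    of window lengths works for every sufficiently long orbit segment.\<close>
  have "\<exists>j N. \<forall>n>N. \<forall>x. real (visits T (R j) n x) < \<eta> * real n"
  proof (rule ccontr)
    assume "\<not> ?thesis"
    then have "\<exists>n>N. \<exists>x. \<eta> * real n \<le> real (visits T (R j) n x)" for j N by (simp add: not_less)
    then obtain \<mu> where "\<mu> \<in> ergodic_measures T" "\<eta> \<le> measure \<mu> (\<Inter>j. R j)"
      by (rule exists_ergodic_measure_charging[OF compact_UNIV continuous_T clR decR])
    then show False using small[of \<mu>] by simp
  qed
  then obtain j N where N: "\<And>n x. N < n \<Longrightarrow> real (visits T (R j) n x) < \<eta> * real n" by blast
  \<comment> \<open>The origin of \<open>5 * \<delta>\<close>: a window costs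
    \<open>h + 2 * \<delta>\<close>, the choice of family and its constant one more \<delta>, and
    tiling by windows another \<open>2 * \<delta>\<close>.\<close>
  have "\<exists>C\<ge>1. \<forall>M. bowen_cover T (8 * e) M {y. real (visits T (- (\<Union>n\<in>{N1..N1 + j}. G n)) M y) \<le> \<eta> * real M}
        (C * exp ((h + 3 * \<delta> + 2 * \<delta>) * real M))"
  proof (rule bowen_cover_tiling_density[OF K])
    show "(\<Sum>n\<in>{N1..N1 + j}. exp (- \<delta> * real n)) \<le> 1 / 2"
      using N2[of N1 "N1 + j"] \<open>N2 \<le> N1\<close> by (simp add: abs_less_iff)
  qed (use h \<delta> \<eta> coverG in \<open>auto simp: N1_def\<close>)
  then obtain C' where C': "1 \<le> C'" "\<And>M. bowen_cover T (8 * e) M {y. real (visits T (R j) M y) \<le> \<eta> * real M}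
        (C' * exp ((h + 3 * \<delta> + 2 * \<delta>) * real M))"
    by (auto simp: R_def)
  show ?thesis
  proof (rule sep_entropy_le_of_bowen_cover)
    show "0 < C'" using C'(1) by simp
    fix M assume "N < M"
    then have "UNIV \<subseteq> {y. real (visits T (R j) M y) \<le> \<eta> * real M}" using N by (auto intro: less_imp_le)
    then show "bowen_cover T (8 * e) M UNIV (C' * exp ((h + 5 * \<delta>) * real M))"
      by (rule bowen_cover_mono[OF C'(2)[of M]]) (simp add: algebra_simps)
  qed
qed

lemma sep_entropy_le:
  assumes "0 < e" "0 \<le> h" "\<And>\<mu>. \<mu> \<in> ergodic_measures T \<Longrightarrow> bk_entropy T \<mu> e < ereal h"
  shows "sep_entropy T UNIV (8 * e) \<le> ereal h"
proof (rule ereal_le_epsilon2)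
  fix d :: real assume "0 < d"
  then show "sep_entropy T UNIV (8 * e) \<le> ereal h + ereal d"
    using sep_entropy_le_add[OF assms(1,2) _ assms(3), of "d / 5"] by simp
qed

text \<open>Every orbit always visits the whole space. Nonemptiness matters because a supremum over
  no measures would be minus infinity in \<open>ereal\<close>.\<close>

lemma ergodic_measures_nonempty: "ergodic_measures T \<noteq> {}"
proof (rule exists_ergodic_measure_charging[OF compact_UNIV continuous_T])
  show "closed (UNIV :: 'a set)" "decseq (\<lambda>j::nat. UNIV :: 'a set)" by (auto simp: decseq_def)
  show "\<exists>n>N. \<exists>x. 1 * real n \<le> real (visits T UNIV n x)" for N
    by (intro exI[of _ "Suc N"]) (simp add: visits_def)
qed blast

lemma sep_entropy_le_SUP_bk_entropy:
  assumes "0 < e"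
  shows "sep_entropy T UNIV (8 * e) \<le> (SUP \<mu>\<in>ergodic_measures T. bk_entropy T \<mu> e)"
proof (rule dense_ge)
  fix s assume s: "(SUP \<mu>\<in>ergodic_measures T. bk_entropy T \<mu> e) < s"
  have "0 \<le> (SUP \<mu>\<in>ergodic_measures T. bk_entropy T \<mu> e)"
    using ergodic_measures_nonempty bk_entropy_nonneg by (auto intro: SUP_upper2)
  then have "0 < s" using s by (rule le_less_trans)
  show "sep_entropy T UNIV (8 * e) \<le> s"
  proof (cases s)
    case (real h)
    have "bk_entropy T \<mu> e < ereal h" if "\<mu> \<in> ergodic_measures T" for \<mu>
      using SUP_upper[OF that, of "\<lambda>\<mu>. bk_entropy T \<mu> e"] s real by (auto intro: le_less_trans)
    then show ?thesis using sep_entropy_le[OF assms, of h] \<open>0 < s\<close> real by simp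
  qed (use \<open>0 < s\<close> in auto)
qed

lemma SUP_bk_entropy_le_sep_entropy:
  assumes "0 < e"
  shows "(SUP \<mu>\<in>ergodic_measures T. bk_entropy T \<mu> e) \<le> sep_entropy T UNIV (e / 3)"
  using bk_entropy_le_sep_entropy[OF _ assms] by (intro SUP_least)

lemma SUP_bk_entropy_nonneg: "0 \<le> (SUP \<mu>\<in>ergodic_measures T. bk_entropy T \<mu> e)"
  using ergodic_measures_nonempty bk_entropy_nonneg by (auto intro: SUP_upper2)

end

section \<open>Change of scale\<close>

lemma at_right_0_scale:
  fixes c :: real
  assumes "0 < c"
  shows "Limsup (at_right 0) (\<lambda>x. h (c * x)) = Limsup (at_right 0) h"
    and "Liminf (at_right 0) (\<lambda>x. h (c * x)) = Liminf (at_right 0) h"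
proof -
  have "filtermap (times c) (at_right 0) = at_right (0::real)"
    using filtermap_times_pos_at_right[OF assms, of 0] by simp
  moreover have "inj (times c)" using assms by (auto intro: injI)
  ultimately show "Limsup (at_right 0) (\<lambda>x. h (c * x)) = Limsup (at_right 0) h"
    and "Liminf (at_right 0) (\<lambda>x. h (c * x)) = Liminf (at_right 0) h"
    using Limsup_filtermap_eq[of "times c" "at_right 0" h] Liminf_filtermap_eq[of "times c" "at_right 0" h] by simp_all
qed

lemma ereal_le_of_le_mult:
  fixes x y :: ereal
  assumes "\<And>t::real. 1 < t \<Longrightarrow> x \<le> ereal t * y"
  shows "x \<le> y"
proof (rule LIMSEQ_le_const)
  have "(\<lambda>n. ereal (1 + 1 / real (Suc n))) \<longlonglongrightarrow> ereal (1 + 0)"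
    using LIMSEQ_inverse_real_of_nat by (intro tendsto_ereal tendsto_add tendsto_const) (simp add: inverse_eq_divide)
  then have "(\<lambda>n. ereal (1 + 1 / real (Suc n)) * y) \<longlonglongrightarrow> 1 * y"
    by (intro tendsto_mult_ereal) (auto simp: one_ereal_def)
  then show "(\<lambda>n. ereal (1 + 1 / real (Suc n)) * y) \<longlonglongrightarrow> y" by simp
  show "\<exists>N. \<forall>n\<ge>N. x \<le> ereal (1 + 1 / real (Suc n)) * y" using assms by auto
qed

text \<open>The quotient of \<open>ln (1 / x)\<close> and \<open>ln (1 / (c * x))\<close> tends to \<open>1\<close>, so a change of scale by a
  constant factor is invisible in both dimensions.\<close>

lemma log_quotient_scale_le:
  fixes f g :: "real \<Rightarrow> ereal"
  assumes c: "0 < c" and le: "\<And>x. 0 < x \<Longrightarrow> f (c * x) \<le> g x" and nonneg: "\<And>x. 0 \<le> g x"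
  shows "Limsup (at_right 0) (\<lambda>x. f x / ereal (ln (1 / x))) \<le> Limsup (at_right 0) (\<lambda>x. g x / ereal (ln (1 / x)))"
    and "Liminf (at_right 0) (\<lambda>x. f x / ereal (ln (1 / x))) \<le> Liminf (at_right 0) (\<lambda>x. g x / ereal (ln (1 / x)))"
proof -
  let ?F = "\<lambda>x. f x / ereal (ln (1 / x))" and ?G = "\<lambda>x. g x / ereal (ln (1 / x))"
  have ev: "\<forall>\<^sub>F x in at_right 0. ?F (c * x) \<le> ereal t * ?G x" if t: "1 < t" for t
  proof -
    have "((\<lambda>x. ln (1 / x) / ln (1 / (c * x))) \<longlongrightarrow> 1) (at_right 0)"
      using c by real_asymp
    then have 1: "\<forall>\<^sub>F x in at_right 0. ln (1 / x) / ln (1 / (c * x)) < t"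
      using t by (rule order_tendstoD)
    have 2: "\<forall>\<^sub>F x in at_right (0::real). 0 < ln (1 / x)" by real_asymp
    have 3: "\<forall>\<^sub>F x in at_right 0. 0 < ln (1 / (c * x))" using c by real_asymp
    show ?thesis
      using 1 2 3 eventually_at_right_less[of 0]
    proof eventually_elim
      fix x :: real assume x: "ln (1 / x) / ln (1 / (c * x)) < t" "0 < ln (1 / x)" "0 < ln (1 / (c * x))" "0 < x"
      have "1 / ln (1 / (c * x)) \<le> t / ln (1 / x)" using x by (simp add: divide_simps mult.commute)
      \<comment> \<open>Nonnegativity of \<open>g x\<close> is what lets the larger coefficient give
        the larger product.\<close>
      then have "ereal (1 / ln (1 / (c * x))) * g x \<le> ereal (t / ln (1 / x)) * g x"
        using nonneg by (intro ereal_mult_right_mono) auto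
      moreover have "ereal (1 / ln (1 / (c * x))) * f (c * x) \<le> ereal (1 / ln (1 / (c * x))) * g x"
        using le[OF x(4)] x(3) by (intro ereal_mult_left_mono) auto
      ultimately have "ereal (1 / ln (1 / (c * x))) * f (c * x) \<le> ereal (t / ln (1 / x)) * g x"
        by (rule order_trans[rotated])
      moreover have "?F (c * x) = ereal (1 / ln (1 / (c * x))) * f (c * x)"
        using x(3) by (simp add: divide_ereal_def mult.commute inverse_eq_divide)
      moreover have "ereal t * ?G x = ereal (t / ln (1 / x)) * g x"
        using x(2) by (simp add: divide_ereal_def inverse_eq_divide mult.assoc[symmetric] mult.commute[of "g x"] times_ereal.simps(1)[symmetric] del: times_ereal.simps)
          (simp add: mult.assoc)
      ultimately show "?F (c * x) \<le> ereal t * ?G x" by simp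
    qed
  qed
  have bot: "at_right (0::real) \<noteq> bot" by simp
  show "Limsup (at_right 0) ?F \<le> Limsup (at_right 0) ?G"
  proof (rule ereal_le_of_le_mult)
    fix t :: real assume t: "1 < t"
    have "Limsup (at_right 0) ?F = Limsup (at_right 0) (\<lambda>x. ?F (c * x))"
      by (rule at_right_0_scale(1)[OF c, symmetric])
    also have "\<dots> \<le> Limsup (at_right 0) (\<lambda>x. ereal t * ?G x)" by (rule Limsup_mono[OF ev[OF t]])
    also have "\<dots> = ereal t * Limsup (at_right 0) ?G" using t by (intro Limsup_ereal_mult_left bot) simp
    finally show "Limsup (at_right 0) ?F \<le> ereal t * Limsup (at_right 0) ?G" .
  qed
  show "Liminf (at_right 0) ?F \<le> Liminf (at_right 0) ?G"
  proof (rule ereal_le_of_le_mult)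
    fix t :: real assume t: "1 < t"
    have "Liminf (at_right 0) ?F = Liminf (at_right 0) (\<lambda>x. ?F (c * x))"
      by (rule at_right_0_scale(2)[OF c, symmetric])
    also have "\<dots> \<le> Liminf (at_right 0) (\<lambda>x. ereal t * ?G x)" by (rule Liminf_mono[OF ev[OF t]])
    also have "\<dots> = ereal t * Liminf (at_right 0) ?G" using t by (intro Liminf_ereal_mult_left bot) simp
    finally show "Liminf (at_right 0) ?F \<le> ereal t * Liminf (at_right 0) ?G" .
  qed
qed

theorem theorem5p2:
  fixes T :: "'a::metric_space \<Rightarrow> 'a"
  assumes "compact (UNIV :: 'a set)"
    and "\<exists>T'. homeomorphism UNIV UNIV T T'"
  shows "upper_mdim T =
           Limsup (at_right 0) (\<lambda>\<epsilon>. 1 / ereal (ln (1 / \<epsilon>)) *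
             (SUP \<mu>\<in>ergodic_measures T. bk_entropy T \<mu> \<epsilon>))
       \<and> lower_mdim T =
           Liminf (at_right 0) (\<lambda>\<epsilon>. 1 / ereal (ln (1 / \<epsilon>)) *
             (SUP \<mu>\<in>ergodic_measures T. bk_entropy T \<mu> \<epsilon>))"
proof -
  interpret compact_system T
    using assms by unfold_locales (auto simp: homeomorphism_def)
  define H where "H e = (SUP \<mu>\<in>ergodic_measures T. bk_entropy T \<mu> e)" for e
  \<comment> \<open>The change of scale asks for nonnegativity at every real argument, while the
    meaning of \<open>sep_entropy\<close> is secured only at positive scales; there the maximum
    changes nothing.\<close>
  define S where "S e = max 0 (sep_entropy T UNIV e)" for e
  have H0: "0 \<le> H e" for e unfolding H_def by (rule SUP_bk_entropy_nonneg)
  have SH: "S (8 * e) \<le> H e" if "0 < e" for e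
    using sep_entropy_le_SUP_bk_entropy[OF that] H0[of e] by (simp add: H_def S_def)
  have HS: "H (3 * e) \<le> S e" if "0 < e" for e
    using SUP_bk_entropy_le_sep_entropy[of "3 * e"] that by (simp add: H_def S_def le_max_iff_disj)
  have S: "S e = sep_entropy T UNIV e" if "0 < e" for e
  proof -
    have "0 \<le> H (3 * e)" by (rule H0)
    also have "\<dots> \<le> sep_entropy T UNIV e"
      using SUP_bk_entropy_le_sep_entropy[of "3 * e"] that by (simp add: H_def)
    finally show ?thesis by (simp add: S_def)
  qed
  have ev: "\<forall>\<^sub>F e in at_right 0. S e / ereal (ln (1 / e)) = sep_entropy T UNIV e / ereal (ln (1 / e))"
    using eventually_at_right_less[of "0::real"] by eventually_elim (simp add: S)
  have H: "1 / ereal (ln (1 / e)) * H e = H e / ereal (ln (1 / e))" for e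
    by (simp add: divide_ereal_def mult.commute)
  have "Limsup (at_right 0) (\<lambda>e. S e / ereal (ln (1 / e))) = Limsup (at_right 0) (\<lambda>e. H e / ereal (ln (1 / e)))"
    "Liminf (at_right 0) (\<lambda>e. S e / ereal (ln (1 / e))) = Liminf (at_right 0) (\<lambda>e. H e / ereal (ln (1 / e)))"
    using log_quotient_scale_le[of 8 S H] log_quotient_scale_le[of 3 H S] SH HS H0
    by (auto intro!: antisym simp: S_def)
  then show ?thesis
    unfolding upper_mdim_def lower_mdim_def H_def[symmetric] H
    using Limsup_eq[OF ev] Liminf_eq[OF ev] by simp
qed

end
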